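(* Suppose that $\alpha$ is the golden ratio, i.e. the positive root of $\alpha^2+\alpha=1$, and let $Tx=x+\alpha$ on $\mathbb{T}=\mathbb{R}/\mathbb{Z}$. Then for every $C^2$-cocycle $\varphi:\mathbb{T}\to SU(2)$ over $T$ we have $d(\varphi)\in 2\pi\mathbb{N}_0$, where $\mathbb{N}_0=\{0,1,2,\dots\}$.
   Context: A $C^2$-cocycle over $T$ is a $C^2$ function $\varphi:\mathbb{T}\to SU(2)$; for $n\ge 1$, $\varphi^{(n)}(x)=\varphi(x)\varphi(Tx)\cdots\varphi(T^{n-1}x)$. $D$ denotes differentiation in $x$, and $D\varphi^{(n)}(x)\,\varphi^{(n)}(x)^{-1}$ lies in the Lie algebra $\mathfrak{su}(2)$ of traceless skew-Hermitian $2\times 2$ matrices, normed by $\|A\|=\sqrt{\det A}$. The sequence $\frac1n D\varphi^{(n)}(\varphi^{(n)})^{-1}$ converges in $L^2(\mathbb{T},\mathfrak{su}(2))$ and a.e. to some $\psi$ with $\|\psi(x)\|$ a.e. constant; the degree $d(\varphi)$ is this constant. Equivalently $d(\varphi)=\lim_n\frac1n\int_{\mathbb{T}}\|D\varphi^{(n)}(x)\varphi^{(n)}(x)^{-1}\|\,dx$. *)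

theory Defs
  imports "HOL-Analysis.Analysis"
begin

definition conj_transpose :: "complex^2^2 \<Rightarrow> complex^2^2" where
  "conj_transpose A = (\<chi> i j. cnj (A $ j $ i))"

definition SU2 :: "(complex^2^2) set" where
  "SU2 = {A. conj_transpose A ** A = mat 1 \<and> det A = 1}"

definition su2 :: "(complex^2^2) set" where
  "su2 = {A. conj_transpose A = - A \<and> trace A = 0}"

text \<open>On \<open>su2\<close> the determinant is real and nonnegative, so taking the real part
  only serves to change the type.\<close>

definition su2_norm :: "complex^2^2 \<Rightarrow> real" where
  "su2_norm A = sqrt (Re (det A))"

text \<open>Functions on the circle \<open>\<real>/\<int>\<close> are represented by \<open>1\<close>-periodic functions on \<open>\<real>\<close>,
  and up to null sets by their restrictions to the fundamental domain \<open>[0,1)\<close>.\<close>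

definition circle_measure :: "real measure" where
  "circle_measure = restrict_space lborel {0..<1}"

definition C2_fun :: "(real \<Rightarrow> 'a::real_normed_vector) \<Rightarrow> bool" where
  "C2_fun f \<longleftrightarrow> (\<exists>f' f''.
     (\<forall>x. (f has_vector_derivative f' x) (at x)) \<and>
     (\<forall>x. (f' has_vector_derivative f'' x) (at x)) \<and>
     continuous_on UNIV f'')"

definition C2_cocycle :: "(real \<Rightarrow> complex^2^2) \<Rightarrow> bool" where
  "C2_cocycle \<phi> \<longleftrightarrow> (\<forall>x. \<phi> x \<in> SU2) \<and> (\<forall>x. \<phi> (x + 1) = \<phi> x) \<and> C2_fun \<phi>"

text \<open>The lift to \<open>\<real>\<close> of the rotation of the circle by \<open>\<alpha>\<close>.\<close>

definition rotation :: "real \<Rightarrow> real \<Rightarrow> real" where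
  "rotation \<alpha> x = x + \<alpha>"

primrec cocycle_iter :: "real \<Rightarrow> (real \<Rightarrow> complex^2^2) \<Rightarrow> nat \<Rightarrow> real \<Rightarrow> complex^2^2" where
  "cocycle_iter \<alpha> \<phi> 0 x = mat 1"
| "cocycle_iter \<alpha> \<phi> (Suc n) x = cocycle_iter \<alpha> \<phi> n x ** \<phi> ((rotation \<alpha> ^^ n) x)"

definition log_deriv :: "(real \<Rightarrow> complex^2^2) \<Rightarrow> real \<Rightarrow> complex^2^2" where
  "log_deriv f x = vector_derivative f (at x) ** matrix_inv (f x)"

definition in_L2_su2 :: "(real \<Rightarrow> complex^2^2) \<Rightarrow> bool" where
  "in_L2_su2 \<psi> \<longleftrightarrow> \<psi> \<in> borel_measurable circle_measure \<and> (\<forall>x. \<psi> x \<in> su2) \<and>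
     integrable circle_measure (\<lambda>x. (su2_norm (\<psi> x))\<^sup>2)"

definition log_deriv_limit :: "real \<Rightarrow> (real \<Rightarrow> complex^2^2) \<Rightarrow> (real \<Rightarrow> complex^2^2) \<Rightarrow> bool" where
  "log_deriv_limit \<alpha> \<phi> \<psi> \<longleftrightarrow> in_L2_su2 \<psi> \<and>
     (\<lambda>n. \<integral>x. (su2_norm ((1 / real n) *\<^sub>R log_deriv (cocycle_iter \<alpha> \<phi> n) x - \<psi> x))\<^sup>2
            \<partial>circle_measure) \<longlonglongrightarrow> 0"

text \<open>The \<open>L\<^sup>2\<close>-limit \<open>\<psi>\<close> is determined almost everywhere by the cocycle, and the degree is the
  a.e. constant value of its norm. The averages also converge to \<open>\<psi>\<close> almost everywhere, but
  this is not needed to single out \<open>\<psi>\<close>.\<close>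

definition cocycle_degree :: "real \<Rightarrow> (real \<Rightarrow> complex^2^2) \<Rightarrow> real" where
  "cocycle_degree \<alpha> \<phi> =
     (THE d. \<exists>\<psi>. log_deriv_limit \<alpha> \<phi> \<psi> \<and> (AE x in circle_measure. su2_norm (\<psi> x) = d))"

end

theory Submission
  imports Defs "HOL-Number_Theory.Fib"
begin

text \<open>
  The logarithmic derivatives of the iterates are Birkhoff sums of the isometry
  \<open>g \<mapsto> \<phi>(x) g(x + \<alpha>) \<phi>(x)\<^sup>*\<close>, so the mean ergodic theorem provides the limit \<open>\<psi>\<close>. It satisfies
  \<open>\<psi>(x) = \<phi>(x) \<psi>(x + \<alpha>) \<phi>(x)\<^sup>*\<close>, hence \<open>\<parallel>\<psi>\<parallel>\<close> is invariant and, by ergodicity of the rotation,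
  almost everywhere equal to a constant \<open>d\<close>.

  Let \<open>q < q'\<close> be consecutive Fibonacci numbers and let \<open>\<delta>, \<delta>'\<close> be \<open>q\<alpha>, q'\<alpha>\<close> modulo 1, so that
  \<open>q'\<delta> - q\<delta>' = \<plusminus>1\<close>. For large \<open>q\<close> there is a point \<open>x\<close> around which both normalised logarithmic
  derivatives are close in mean to \<open>H = \<psi>(x)\<close> on windows of length \<open>\<bar>\<delta>\<bar>, \<bar>\<delta>'\<bar>\<close>, and where \<open>P\<close> and \<open>Q\<close>,
  the values of the \<open>q\<close>-th and \<open>q'\<close>-th iterate, nearly commute with \<open>H\<close>. Integrating over the windows
  turns the identity \<open>\<phi>\<^sub>q(x) \<phi>\<^sub>q\<^sub>'(x + \<delta>) = \<phi>\<^sub>q\<^sub>'(x) \<phi>\<^sub>q(x + \<delta>')\<close> into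
  \<open>P exp(q'\<delta>H) Q \<approx> Q exp(q\<delta>'H) P\<close>. If \<open>d \<noteq> 0\<close>, then \<open>P\<close>, \<open>Q\<close> and the exponentials all nearly lie in
  the maximal torus of \<open>H\<close>, so \<open>exp(\<plusminus>H) = 1\<close> in the limit; as \<open>H\<close> has eigenvalues \<open>\<plusminus>\<i>d\<close>, this
  means \<open>d \<in> 2\<pi>\<int>\<close>.
\<close>

section \<open>The group SU(2) and its Lie algebra\<close>

lemma norm_matrix_power2: "(norm (A :: complex^'n^'m))\<^sup>2 = (\<Sum>i\<in>UNIV. \<Sum>j\<in>UNIV. (norm (A $ i $ j))\<^sup>2)"
  by (simp add: norm_vec_def L2_set_def sum_nonneg)

lemma conj_transpose_nth [simp]: "conj_transpose A $ i $ j = cnj (A $ j $ i)"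
  by (simp add: conj_transpose_def)

lemma conj_transpose_conj_transpose [simp]: "conj_transpose (conj_transpose A) = A"
  by (simp add: vec_eq_iff)

lemma conj_transpose_mult: "conj_transpose (A ** B) = conj_transpose B ** conj_transpose A"
  by (simp add: vec_eq_iff matrix_matrix_mult_def mult.commute)

lemma conj_transpose_mat_1 [simp]: "conj_transpose (mat 1) = mat 1"
  by (auto simp add: vec_eq_iff mat_def)

lemma norm_conj_transpose [simp]: "norm (conj_transpose A) = norm A"
proof -
  have "(norm (conj_transpose A))\<^sup>2 = (norm A)\<^sup>2"
    unfolding norm_matrix_power2 by (subst sum.swap) simp
  then show ?thesis by simp
qed

lemma bounded_linear_conj_transpose: "bounded_linear conj_transpose"
  by (rule bounded_linear_intro[where K = 1])
    (simp_all add: vec_eq_iff)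

lemmas conj_transpose_add = linear_add[OF bounded_linear.linear[OF bounded_linear_conj_transpose]]
lemmas conj_transpose_scaleR = linear_scale[OF bounded_linear.linear[OF bounded_linear_conj_transpose]]

text \<open>In finite dimension bilinearity implies boundedness. The interpretation below then
  provides the sum, limit, continuity and derivative rules for \<open>**\<close>.\<close>

lemma bounded_bilinear_matrix_mult:
  "bounded_bilinear ((**) :: complex^2^2 \<Rightarrow> complex^2^2 \<Rightarrow> complex^2^2)"
  unfolding bilinear_conv_bounded_bilinear[symmetric] bilinear_def
  by (auto intro!: linearI simp: vec_eq_iff matrix_matrix_mult_def algebra_simps sum.distrib
      scaleR_sum_right)

interpretation matrix_mult: bounded_bilinear "(**) :: complex^2^2 \<Rightarrow> complex^2^2 \<Rightarrow> complex^2^2"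
  by (rule bounded_bilinear_matrix_mult)

text \<open>Coordinates that identify SU(2) with the unit sphere in pairs of complex numbers: the
  first row determines the matrix. Closedness, isometry and derivatives are read off from these
  equations.\<close>

lemma SU2_iff:
  "A \<in> SU2 \<longleftrightarrow> A $ 2 $ 2 = cnj (A $ 1 $ 1) \<and> A $ 2 $ 1 = - cnj (A $ 1 $ 2)
     \<and> A $ 1 $ 1 * cnj (A $ 1 $ 1) + A $ 1 $ 2 * cnj (A $ 1 $ 2) = 1"
  (is "_ \<longleftrightarrow> ?R")
proof
  assume "A \<in> SU2"
  then have u: "conj_transpose A ** A = mat 1" and d: "det A = 1"
    by (auto simp: SU2_def)
  have "A ** conj_transpose A = mat 1"
    using u matrix_left_right_inverse by blast
  then have e: "A $ 1 $ 1 * cnj (A $ 1 $ 1) + A $ 1 $ 2 * cnj (A $ 1 $ 2) = 1"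
     "A $ 1 $ 1 * cnj (A $ 2 $ 1) + A $ 1 $ 2 * cnj (A $ 2 $ 2) = 0"
    by (auto simp: vec_eq_iff matrix_matrix_mult_def sum_2 mat_def forall_2)
  from e(2) have e2: "cnj (A $ 1 $ 1) * A $ 2 $ 1 + cnj (A $ 1 $ 2) * A $ 2 $ 2 = 0"
    by (metis complex_cnj_add complex_cnj_cnj complex_cnj_mult complex_cnj_zero)
  have e3: "A $ 1 $ 1 * A $ 2 $ 2 - A $ 1 $ 2 * A $ 2 $ 1 = 1"
    using d by (simp add: det_2)
  \<comment> \<open>Cramer's rule for the second row \<open>c\<close>, \<open>e\<close>: the last
    two equations are linear in it, with determinant \<open>a * a' + b * b' = 1\<close>.\<close>
  have eqs: "e = a'" "c = - b'"
    if "a * a' + b * b' = 1" "a' * c + b' * e = 0" "a * e - b * c = 1" for a b c e a' b' :: complex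
  proof -
    have "e = e * (a * a' + b * b')" "c = c * (a * a' + b * b')"
      using that by simp_all
    moreover have "e * (a * a' + b * b') = a' * (a * e - b * c) + b * (a' * c + b' * e)"
      "c * (a * a' + b * b') = a * (a' * c + b' * e) - b' * (a * e - b * c)"
      by (simp_all add: algebra_simps)
    ultimately show "e = a'" "c = - b'" using that by simp_all
  qed
  have "A $ 2 $ 2 = cnj (A $ 1 $ 1)" "A $ 2 $ 1 = - cnj (A $ 1 $ 2)"
    using eqs[OF e(1) e2 e3] by simp_all
  then show ?R using e by blast
next
  assume ?R
  then show "A \<in> SU2"
    by (auto simp: SU2_def vec_eq_iff matrix_matrix_mult_def sum_2 mat_def forall_2 det_2 algebra_simps)
qed

lemma SU2_mult_conj_transpose:
  assumes "A \<in> SU2"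
  shows "conj_transpose A ** A = mat 1" "A ** conj_transpose A = mat 1"
  using assms matrix_left_right_inverse by (auto simp: SU2_def)

lemma SU2_mult: "A \<in> SU2 \<Longrightarrow> B \<in> SU2 \<Longrightarrow> A ** B \<in> SU2"
  by (simp add: SU2_def det_mul conj_transpose_mult)
    (metis matrix_mul_assoc matrix_mul_lid)

lemma mat_1_SU2 [simp]: "mat 1 \<in> SU2"
  by (simp add: SU2_def)

lemma matrix_inv_SU2:
  assumes "A \<in> SU2"
  shows "matrix_inv A = conj_transpose A"
proof -
  have "A ** matrix_inv A = mat 1 \<and> matrix_inv A ** A = mat 1"
    unfolding matrix_inv_def
    by (rule someI[where x = "conj_transpose A"]) (simp add: SU2_mult_conj_transpose assms)
  then show ?thesis
    by (metis SU2_mult_conj_transpose(1)[OF assms] matrix_mul_assoc matrix_mul_lid matrix_mul_rid)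
qed

text \<open>The norm is the Frobenius norm and \<open>A\<close> acts on each column of
  \<open>X\<close> separately, so it is enough that \<open>A\<close> preserves the length of a
  vector.\<close>

lemma norm_SU2_mult_left:
  fixes X :: "complex^2^2"
  assumes "A \<in> SU2"
  shows "norm (A ** X) = norm X"
proof -
  obtain a b where A: "A $ 1 $ 1 = a" "A $ 1 $ 2 = b" "A $ 2 $ 1 = - cnj b" "A $ 2 $ 2 = cnj a"
      "a * cnj a + b * cnj b = 1"
    using assms unfolding SU2_iff by metis
  have *: "(norm (a * x + b * y))\<^sup>2 + (norm (- cnj b * x + cnj a * y))\<^sup>2 = (norm x)\<^sup>2 + (norm y)\<^sup>2" for x y
  proof -
    have "of_real ((norm (a * x + b * y))\<^sup>2 + (norm (- cnj b * x + cnj a * y))\<^sup>2) =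
      (a * cnj a + b * cnj b) * (x * cnj x + y * cnj y)"
      by (simp only: of_real_add complex_norm_square) (simp add: algebra_simps)
    also have "\<dots> = of_real ((norm x)\<^sup>2 + (norm y)\<^sup>2)"
      by (simp only: of_real_add complex_norm_square A(5) mult_1)
    finally show ?thesis
      unfolding of_real_eq_iff .
  qed
  have "(norm (A ** X))\<^sup>2 = (norm X)\<^sup>2"
    unfolding norm_matrix_power2 matrix_matrix_mult_def sum_2 
    using *[of "X $ 1 $ 1" "X $ 2 $ 1"] *[of "X $ 1 $ 2" "X $ 2 $ 2"]
    by (simp add: A)
  then show ?thesis by simp
qed

lemma conj_transpose_SU2: "A \<in> SU2 \<Longrightarrow> conj_transpose A \<in> SU2"
  by (auto simp: SU2_iff algebra_simps)

lemma norm_SU2_mult_right: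
  fixes X :: "complex^2^2"
  assumes "A \<in> SU2"
  shows "norm (X ** A) = norm X"
  by (metis assms conj_transpose_SU2 conj_transpose_mult norm_SU2_mult_left norm_conj_transpose)

lemma norm_SU2: "A \<in> SU2 \<Longrightarrow> norm A = norm (mat 1 :: complex^2^2)"
  by (metis matrix_mul_rid norm_SU2_mult_left)

lemma compact_SU2: "compact SU2"
proof -
  have eq: "SU2 = {A. A $ 2 $ 2 = cnj (A $ 1 $ 1) \<and> A $ 2 $ 1 = - cnj (A $ 1 $ 2)
     \<and> A $ 1 $ 1 * cnj (A $ 1 $ 1) + A $ 1 $ 2 * cnj (A $ 1 $ 2) = 1}"
    by (auto simp: SU2_iff)
  have "closed SU2"
    unfolding eq by (intro closed_Collect_conj closed_Collect_eq continuous_intros)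
  moreover have "bounded SU2"
    by (metis boundedI norm_SU2 order_refl)
  ultimately show ?thesis by (simp add: compact_eq_bounded_closed)
qed

section \<open>The Lie algebra su(2): closure properties, norm and centralizers\<close>

lemma su2_iff:
  "H \<in> su2 \<longleftrightarrow> cnj (H $ 1 $ 1) = - H $ 1 $ 1 \<and> H $ 2 $ 2 = - H $ 1 $ 1 \<and> H $ 2 $ 1 = - cnj (H $ 1 $ 2)"
  by (auto simp: su2_def vec_eq_iff forall_2 trace_def sum_2 add_eq_0_iff2 complex_cnj_minus)

lemma su2_zero [simp]: "0 \<in> su2"
  by (simp add: su2_iff)

lemma su2_add: "A \<in> su2 \<Longrightarrow> B \<in> su2 \<Longrightarrow> A + B \<in> su2"
  by (simp add: su2_iff)

lemma su2_diff: "A \<in> su2 \<Longrightarrow> B \<in> su2 \<Longrightarrow> A - B \<in> su2"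
  by (simp add: su2_iff)

lemma su2_scaleR: "A \<in> su2 \<Longrightarrow> c *\<^sub>R A \<in> su2"
  by (simp add: su2_iff)

lemma su2_sum: "(\<And>i. i \<in> I \<Longrightarrow> f i \<in> su2) \<Longrightarrow> sum f I \<in> su2"
  by (induction I rule: infinite_finite_induct) (auto intro: su2_add)

lemma closed_su2: "closed su2"
proof -
  have eq: "su2 = {H. cnj (H $ 1 $ 1) = - H $ 1 $ 1 \<and> H $ 2 $ 2 = - H $ 1 $ 1 \<and>
      H $ 2 $ 1 = - cnj (H $ 1 $ 2)}"
    by (auto simp: su2_iff)
  show ?thesis
    unfolding eq by (intro closed_Collect_conj closed_Collect_eq continuous_intros)
qed

lemma su2_conjugate:
  assumes "A \<in> SU2" "X \<in> su2"
  shows "A ** X ** conj_transpose A \<in> su2"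
proof -
  have "conj_transpose (A ** X ** conj_transpose A) = - (A ** X ** conj_transpose A)"
  proof -
    have "conj_transpose X = - X" using assms(2) by (simp add: su2_def)
    then show ?thesis
      unfolding conj_transpose_mult conj_transpose_conj_transpose
      by (simp only: matrix_mult.minus_left matrix_mult.minus_right matrix_mul_assoc)
  qed
  moreover have "trace (A ** X ** conj_transpose A) = trace (conj_transpose A ** (A ** X))"
    by (rule trace_mul_sym)
  moreover have "conj_transpose A ** (A ** X) = X"
    by (metis SU2_mult_conj_transpose(1) assms(1) matrix_mul_assoc matrix_mul_lid)
  ultimately show ?thesis
    using assms(2) unfolding su2_def by simp
qed

text \<open>The determinant is half the sum of the squared moduli of the entries. This is why a
  degree \<open>d\<close> appears below in the form \<open>norm H = sqrt 2 * d\<close>.\<close>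

lemma su2_norm_eq:
  assumes "H \<in> su2"
  shows "su2_norm H = norm H / sqrt 2"
proof -
  obtain u where u: "H $ 1 $ 1 = \<i> * of_real u"
    using assms by (auto simp: su2_iff complex_eq_iff intro!: that[of "Im (H $ 1 $ 1)"])
  have "(norm H)\<^sup>2 = 2 * Re (det H)"
    using assms unfolding su2_iff norm_matrix_power2 sum_2 det_2
    by (simp add: u norm_mult cmod_power2) (simp add: power2_eq_square)
  then have "norm H = sqrt (2 * Re (det H))"
    by (metis norm_ge_zero real_sqrt_unique)
  then show ?thesis
    by (simp add: su2_norm_def real_sqrt_mult)
qed

text \<open>Cayley-Hamilton for a matrix of trace zero and determinant \<open>d\<^sup>2\<close>; the
  eigenvalues are plus and minus \<open>\<i> * d\<close>.\<close>

lemma su2_square: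
  assumes "H \<in> su2" "norm H = sqrt 2 * d"
  shows "H ** H = - (d\<^sup>2) *\<^sub>R mat 1"
proof -
  obtain u where u: "H $ 1 $ 1 = \<i> * of_real u"
    using assms by (auto simp: su2_iff complex_eq_iff intro!: that[of "Im (H $ 1 $ 1)"])
  have "2 * d\<^sup>2 = (norm H)\<^sup>2"
    by (simp add: assms(2) power_mult_distrib)
  also have "\<dots> = 2 * (u\<^sup>2 + (norm (H $ 1 $ 2))\<^sup>2)"
    using assms unfolding su2_iff norm_matrix_power2 sum_2
    by (simp add: u norm_mult)
  finally have d: "d\<^sup>2 = u\<^sup>2 + (norm (H $ 1 $ 2))\<^sup>2" by simp
  have "of_real (d\<^sup>2) = of_real u ^ 2 + H $ 1 $ 2 * cnj (H $ 1 $ 2)"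
    unfolding d of_real_add complex_norm_square by simp
  then show ?thesis
    using assms(1) unfolding su2_iff
    by (simp add: vec_eq_iff forall_2 matrix_matrix_mult_def sum_2 mat_def u
        algebra_simps power2_eq_square flip: scaleR_conv_of_real)
      (simp add: scaleR_conv_of_real)
qed

text \<open>A nonzero \<open>H\<close> of trace zero is not scalar, so its centralizer among the 2
  by 2 matrices is commutative: the trace-free parts of \<open>P\<close> and \<open>Q\<close> are
  complex multiples of \<open>H\<close>.\<close>

lemma commute_of_commute_su2:
  assumes "H \<in> su2" "H \<noteq> 0" "P ** H = H ** P" "Q ** H = H ** Q"
  shows "P ** Q = Q ** P"
proof -
  define a b where "a = H $ 1 $ 1" and "b = H $ 1 $ 2"
  have h: "H $ 2 $ 2 = - a" "H $ 2 $ 1 = - cnj b" "H $ 1 $ 1 = a" "H $ 1 $ 2 = b"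
    using assms(1) by (simp_all add: su2_iff a_def b_def)
  have ab: "a \<noteq> 0 \<or> b \<noteq> 0"
    using assms(2) h by (auto simp: vec_eq_iff forall_2)
  define c where "c = cnj b"
  have bc: "b = 0 \<Longrightarrow> c = 0" by (simp add: c_def)
  define p11 p12 p21 p22 where p: "p11 = P $ 1 $ 1" "p12 = P $ 1 $ 2" "p21 = P $ 2 $ 1" "p22 = P $ 2 $ 2"
  define q11 q12 q21 q22 where q: "q11 = Q $ 1 $ 1" "q12 = Q $ 1 $ 2" "q21 = Q $ 2 $ 1" "q22 = Q $ 2 $ 2"
  have P: "p12 * c = - b * p21" "(p11 - p22) * b = 2 * a * p12" "(p22 - p11) * c = 2 * a * p21"
    using assms(3) by (auto simp: vec_eq_iff forall_2 matrix_matrix_mult_def sum_2 h p c_def algebra_simps)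
  have Q: "q12 * c = - b * q21" "(q11 - q22) * b = 2 * a * q12" "(q22 - q11) * c = 2 * a * q21"
    using assms(4) by (auto simp: vec_eq_iff forall_2 matrix_matrix_mult_def sum_2 h q c_def algebra_simps)
  \<comment> \<open>These vanishing minors say that the off-diagonal entries and the diagonal
    differences of \<open>P\<close> and \<open>Q\<close> are proportional, which is exactly what
    \<open>P ** Q = Q ** P\<close> requires.\<close>
  have "p12 * q21 = q12 * p21 \<and> (p11 - p22) * q12 = (q11 - q22) * p12 \<and> (p11 - p22) * q21 = (q11 - q22) * p21"
  proof (cases "b = 0")
    case True
    then have "a \<noteq> 0" using ab by blast
    then show ?thesis using P Q True bc by auto
  next
    case False
    have "b * (p12 * q21) = p12 * - (q12 * c)" "b * (q12 * p21) = q12 * - (p12 * c)"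
      unfolding P(1) Q(1) by simp_all
    then have 1: "p12 * q21 = q12 * p21"
      using False by (metis minus_mult_commute mult.left_commute mult_cancel_left)
    have 2: "b * ((p11 - p22) * z) = 2 * a * p12 * z" "b * ((q11 - q22) * z) = 2 * a * q12 * z" for z
      using P(2) Q(2) by (metis mult.assoc mult.commute)+
    have "b * ((p11 - p22) * q12) = b * ((q11 - q22) * p12)"
      "b * ((p11 - p22) * q21) = b * ((q11 - q22) * p21)"
      unfolding 2 using 1 by (simp_all add: mult.assoc)
    then show ?thesis using False 1 by simp
  qed
  then show ?thesis
    by (simp add: vec_eq_iff forall_2 matrix_matrix_mult_def sum_2 p[symmetric] q[symmetric] algebra_simps)
qed

section \<open>One-parameter subgroups of SU(2)\<close>

text \<open>For \<open>norm H = sqrt 2 * d\<close> and \<open>d > 0\<close> this is the matrix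
  exponential of \<open>s *\<^sub>R H\<close>: by \<open>su2_square\<close> the even powers of
  \<open>H\<close> are scalar and the odd ones are multiples of \<open>H\<close>, so the series
  collapses.\<close>

definition su2_exp :: "real \<Rightarrow> complex^2^2 \<Rightarrow> real \<Rightarrow> complex^2^2" where
  "su2_exp d H s = cos (s * d) *\<^sub>R mat 1 + (sin (s * d) / d) *\<^sub>R H"

lemma su2_exp_0 [simp]: "su2_exp d H 0 = mat 1"
  by (simp add: su2_exp_def)

lemma su2_exp_commute: "su2_exp d H s ** H = H ** su2_exp d H s"
  by (simp add: su2_exp_def matrix_mult.add_left matrix_mult.add_right matrix_mult.scaleR_left matrix_mult.scaleR_right)

lemma su2_exp_SU2:
  assumes "H \<in> su2" "norm H = sqrt 2 * d" "d > 0"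
  shows "su2_exp d H s \<in> SU2"
proof -
  obtain u where u: "H $ 1 $ 1 = \<i> * of_real u"
    using assms by (auto simp: su2_iff complex_eq_iff intro!: that[of "Im (H $ 1 $ 1)"])
  define a b c e where "a = cos (s * d)" "b = sin (s * d) / d" "c = Re (H $ 1 $ 2)" "e = Im (H $ 1 $ 2)"
  have h: "H $ 1 $ 2 = Complex c e" "H $ 2 $ 1 = Complex (- c) e" "H $ 2 $ 2 = Complex 0 (-u)" "H $ 1 $ 1 = Complex 0 u"
    using assms(1) by (auto simp: su2_iff u complex_eq_iff a_b_c_e_def)
  have "2 * d\<^sup>2 = (norm H)\<^sup>2"
    by (simp add: assms(2) power_mult_distrib)
  also have "\<dots> = 2 * (u\<^sup>2 + c\<^sup>2 + e\<^sup>2)"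
    unfolding norm_matrix_power2 sum_2 h by (simp add: cmod_power2)
  finally have d: "u\<^sup>2 + c\<^sup>2 + e\<^sup>2 = d\<^sup>2" by simp
  have "a\<^sup>2 + b\<^sup>2 * (u\<^sup>2 + c\<^sup>2 + e\<^sup>2) = 1"
    unfolding d using assms(3) by (simp add: a_b_c_e_def power_divide)
  then show ?thesis
    by (simp add: SU2_iff su2_exp_def h mat_def complex_eq_iff power2_eq_square
        flip: a_b_c_e_def) (simp add: algebra_simps)
qed

lemma conj_transpose_su2_exp: "H \<in> su2 \<Longrightarrow> conj_transpose (su2_exp d H s) = su2_exp d H (- s)"
  by (simp add: su2_exp_def conj_transpose_add conj_transpose_scaleR) (simp add: su2_def)

lemma su2_exp_has_vector_derivative:
  assumes "H \<in> su2" "norm H = sqrt 2 * d" "d > 0"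
  shows "(su2_exp d H has_vector_derivative H ** su2_exp d H s) (at s within X)"
proof -
  have "((\<lambda>s. cos (s * d) *\<^sub>R mat 1 + (sin (s * d) / d) *\<^sub>R H) has_vector_derivative
       (- sin (s * d) * d) *\<^sub>R mat 1 + cos (s * d) *\<^sub>R H) (at s within X)"
    using assms(3) by (auto intro!: derivative_eq_intros)
  moreover have "H ** su2_exp d H s = (- sin (s * d) * d) *\<^sub>R mat 1 + cos (s * d) *\<^sub>R H"
    using assms(3) by (simp add: su2_exp_def matrix_mult.add_right matrix_mult.scaleR_right su2_square[OF assms(1,2)]
        power2_eq_square)
  ultimately show ?thesis
    by (simp add: su2_exp_def[abs_def])
qed

text \<open>\<open>P\<close>, \<open>Q\<close> and the exponentials all lie in the commutative
  centralizer of \<open>H\<close>. Cancelling \<open>P ** Q\<close> leaves equal exponentials at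
  \<open>s\<close> and \<open>s'\<close>, whose distance is 1.\<close>

lemma cos_eq_1_of_commuting:
  assumes H: "H \<in> su2" "norm H = sqrt 2 * d" "d > 0"
    and P: "P \<in> SU2" "P ** H = H ** P" and Q: "Q \<in> SU2" "Q ** H = H ** Q"
    and s: "\<bar>s - s'\<bar> = 1"
    and eq: "P ** su2_exp d H s ** Q = Q ** su2_exp d H s' ** P"
  shows "cos d = 1"
proof -
  have nz: "H \<noteq> 0" using H by auto
  have E: "su2_exp d H t ** H = H ** su2_exp d H t" for t
    by (rule su2_exp_commute)
  have "P ** Q ** su2_exp d H s = P ** su2_exp d H s ** Q"
    using commute_of_commute_su2[OF H(1) nz Q(2) E, of s] by (simp flip: matrix_mul_assoc)
  also have "\<dots> = P ** Q ** su2_exp d H s'"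
    unfolding eq commute_of_commute_su2[OF H(1) nz P(2) Q(2)]
    using commute_of_commute_su2[OF H(1) nz P(2) E, of s'] by (simp flip: matrix_mul_assoc)
  finally have "conj_transpose (P ** Q) ** (P ** Q) ** su2_exp d H s =
      conj_transpose (P ** Q) ** (P ** Q) ** su2_exp d H s'"
    by (simp flip: matrix_mul_assoc)
  then have e: "su2_exp d H s = su2_exp d H s'"
    by (simp add: SU2_mult_conj_transpose SU2_mult P(1) Q(1))
  \<comment> \<open>\<open>H\<close> has trace zero, so the trace isolates the cosine. Then
    \<open>H \<noteq> 0\<close> forces the coefficients of \<open>H\<close>, hence the sines, to
    agree as well.\<close>
  have "trace (su2_exp d H t) = 2 * of_real (cos (t * d))" for t
    using H(1) by (simp add: trace_def sum_2 su2_exp_def mat_def su2_iff) (simp add: scaleR_conv_of_real)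
  with e have c: "cos (s * d) = cos (s' * d)"
    by (metis mult_cancel_left of_real_eq_iff zero_neq_numeral)
  with e nz H(3) have sn: "sin (s * d) = sin (s' * d)"
    by (simp add: su2_exp_def)
  have "cos ((s - s') * d) = (cos (s' * d))\<^sup>2 + (sin (s' * d))\<^sup>2"
    by (simp add: left_diff_distrib cos_diff c sn power2_eq_square)
  moreover have "cos ((s - s') * d) = cos d"
  proof -
    consider "s - s' = 1" | "s - s' = - 1" using s by linarith
    then show ?thesis by cases (simp_all only: mult_1 mult_minus_left cos_minus)
  qed
  ultimately show ?thesis by simp
qed

text \<open>The exact relations of \<open>cos_eq_1_of_commuting\<close> are reached by minimising the total
  defect over a compact set.\<close>

lemma cos_eq_1_of_almost_commuting:
  assumes d: "d > 0"
    and approx: "\<And>\<epsilon>. \<epsilon> > 0 \<Longrightarrow> \<exists>P\<in>SU2. \<exists>Q\<in>SU2. \<exists>H\<in>su2. \<exists>s s'. norm H = sqrt 2 * d \<and>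
        \<bar>s\<bar> \<le> 1 \<and> \<bar>s'\<bar> \<le> 1 \<and> \<bar>s - s'\<bar> = 1 \<and>
        norm (P ** H - H ** P) < \<epsilon> \<and> norm (Q ** H - H ** Q) < \<epsilon> \<and>
        norm (P ** su2_exp d H s ** Q - Q ** su2_exp d H s' ** P) < \<epsilon>"
  shows "cos d = 1"
proof -
  \<comment> \<open>The bounds on \<open>s\<close> and \<open>s'\<close> make \<open>K\<close>
    compact. The other constraints are closed, so a minimiser satisfies them too.\<close>
  define K where "K = SU2 \<times> SU2 \<times> (su2 \<inter> sphere 0 (sqrt 2 * d)) \<times>
      (({-1..1} \<times> {-1..1 :: real}) \<inter> {(s, s'). \<bar>s - s'\<bar> = 1})"
  define F where "F = (\<lambda>(P, Q, H, s, s'). norm (P ** H - H ** P) + norm (Q ** H - H ** Q) +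
        norm (P ** su2_exp d H s ** Q - Q ** su2_exp d H s' ** P))"
  have cl: "closed {(s, s'). \<bar>s - s' :: real\<bar> = 1}"
    unfolding split_def by (intro closed_Collect_eq continuous_intros)
  have "compact K"
    unfolding K_def by (intro compact_Times compact_SU2 closed_Int_compact[OF closed_su2]
        compact_Int_closed cl compact_sphere compact_Icc)
  moreover have "K \<noteq> {}"
  proof -
    obtain P Q H s s' where "P \<in> SU2" "Q \<in> SU2" "H \<in> su2" "norm H = sqrt 2 * d"
        "\<bar>s\<bar> \<le> 1" "\<bar>s'\<bar> \<le> 1" "\<bar>s - s' :: real\<bar> = 1"
      using approx[of 1] by auto
    then have "(P, Q, H, s, s') \<in> K" by (auto simp: K_def)
    then show ?thesis by blast
  qed
  moreover have "continuous_on K F"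
    unfolding F_def split_def su2_exp_def using d
    by (intro continuous_intros matrix_mult.continuous_on) auto
  ultimately obtain z where z: "z \<in> K" "\<And>y. y \<in> K \<Longrightarrow> F z \<le> F y"
    using continuous_attains_inf[of K F] by blast
  have "F z \<le> 0"
  proof (rule field_le_epsilon)
    fix e :: real assume e: "e > 0"
    obtain P Q H s s' where "P \<in> SU2" "Q \<in> SU2" "H \<in> su2" "norm H = sqrt 2 * d"
        "\<bar>s\<bar> \<le> 1" "\<bar>s'\<bar> \<le> 1" "\<bar>s - s' :: real\<bar> = 1" and
        lt: "norm (P ** H - H ** P) < e / 3" "norm (Q ** H - H ** Q) < e / 3"
        "norm (P ** su2_exp d H s ** Q - Q ** su2_exp d H s' ** P) < e / 3"
      using approx[OF divide_pos_pos[OF e zero_less_numeral]] by blast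
    then have "(P, Q, H, s, s') \<in> K" by (auto simp: K_def)
    then have "F z \<le> F (P, Q, H, s, s')" by (rule z)
    also have "\<dots> \<le> e" using lt by (simp add: F_def)
    finally show "F z \<le> 0 + e" by simp
  qed
  obtain P Q H s s' where zz: "z = (P, Q, H, s, s')" by (cases z) auto
  have n0: "a = 0 \<and> b = 0 \<and> c = 0" if "norm a + norm b + norm c \<le> 0" for a b c :: "complex^2^2"
    using that by (smt (verit) norm_ge_zero norm_eq_zero)
  from \<open>F z \<le> 0\<close> have "P ** H - H ** P = 0 \<and> Q ** H - H ** Q = 0 \<and> P ** su2_exp d H s ** Q - Q ** su2_exp d H s' ** P = 0"
    unfolding zz F_def by (intro n0) simp
  then show ?thesis
    using z(1) unfolding zz K_def by (intro cos_eq_1_of_commuting[of H d P Q s s'] d) auto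
qed

section \<open>Integration over the circle\<close>

lemma space_circle_measure [simp]: "space circle_measure = {0..<1}"
  by (simp add: circle_measure_def space_restrict_space)

lemma emeasure_circle_measure: "emeasure circle_measure {0..<1} = 1"
  by (simp add: circle_measure_def emeasure_restrict_space)

lemma finite_measure_circle_measure: "finite_measure circle_measure"
  by (rule finite_measureI) (simp add: emeasure_circle_measure)

lemma measure_circle_measure [simp]: "measure circle_measure {0..<1} = 1"
  by (simp add: measure_def emeasure_circle_measure)

lemma measurable_circle_measure: "f \<in> borel_measurable borel \<Longrightarrow> f \<in> borel_measurable circle_measure"
  by (simp add: circle_measure_def measurable_restrict_space1)

lemma periodic_int:
  fixes f :: "real \<Rightarrow> 'a"
  assumes "\<And>x. f (x + 1) = f x"
  shows "f (x + of_int k) = f x"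
proof (induction k arbitrary: x rule: int_induct[where k = 0])
  case (step1 i)
  then show ?case using assms by (metis add.assoc of_int_1 of_int_add)
next
  case (step2 i)
  then show ?case using assms[of "x + of_int (i - 1)"] by (simp add: algebra_simps)
qed simp

text \<open>The fundamental domain is moved by the translation. After reducing \<open>t\<close> to
  its fractional part \<open>s\<close>, the piece of \<open>[s, s + 1)\<close> beyond 1 is carried
  back to \<open>[0, s)\<close> by periodicity.\<close>

lemma nn_integral_circle_shift:
  fixes f :: "real \<Rightarrow> ennreal"
  assumes [measurable]: "f \<in> borel_measurable borel" and per: "\<And>x. f (x + 1) = f x"
  shows "(\<integral>\<^sup>+x. f (x + t) \<partial>circle_measure) = (\<integral>\<^sup>+x. f x \<partial>circle_measure)"
proof -
  have circ: "(\<integral>\<^sup>+x. g x \<partial>circle_measure) = (\<integral>\<^sup>+x. g x * indicator {0..<1} x \<partial>lborel)" for g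
    by (simp add: circle_measure_def nn_integral_restrict_space)
  define s where "s = frac t"
  have s: "0 \<le> s" "s < 1" by (simp_all add: s_def frac_lt_1)
  have ft: "f (x + t) = f (x + s)" for x
    using periodic_int[of f "x + s" "\<lfloor>t\<rfloor>", OF per] by (simp add: s_def frac_def algebra_simps)
  have "(\<integral>\<^sup>+x. f x * indicator {s..<s+1} x \<partial>lborel) = (\<integral>\<^sup>+x. f (x + s) * indicator {0..<1} x \<partial>lborel)"
    by (subst nn_integral_real_affine[where c = 1 and t = s])
      (auto simp: algebra_simps indicator_def intro!: nn_integral_cong)
  moreover have "(\<integral>\<^sup>+x. f x * indicator {1..<s+1} x \<partial>lborel) = (\<integral>\<^sup>+x. f x * indicator {0..<s} x \<partial>lborel)"
    by (subst nn_integral_real_affine[where c = 1 and t = 1])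
      (auto simp: indicator_def per add.commute[of 1] intro!: nn_integral_cong)
  moreover have "(\<integral>\<^sup>+x. f x * indicator {s..<s+1} x \<partial>lborel) =
      (\<integral>\<^sup>+x. f x * indicator {s..<1} x \<partial>lborel) + (\<integral>\<^sup>+x. f x * indicator {1..<s+1} x \<partial>lborel)"
    using s by (subst nn_integral_add[symmetric])
      (auto simp: indicator_def intro!: nn_integral_cong)
  moreover have "(\<integral>\<^sup>+x. f x * indicator {0..<1} x \<partial>lborel) =
      (\<integral>\<^sup>+x. f x * indicator {s..<1} x \<partial>lborel) + (\<integral>\<^sup>+x. f x * indicator {0..<s} x \<partial>lborel)"
    using s by (subst nn_integral_add[symmetric])
      (auto simp: indicator_def intro!: nn_integral_cong)
  ultimately show ?thesis
    by (simp add: circ ft)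
qed

lemma integral_circle_shift:
  fixes f :: "real \<Rightarrow> real"
  assumes [measurable]: "f \<in> borel_measurable borel" and per: "\<And>x. f (x + 1) = f x"
    and nonneg: "\<And>x. 0 \<le> f x"
  shows "(\<integral>x. f (x + t) \<partial>circle_measure) = (\<integral>x. f x \<partial>circle_measure)"
proof -
  have "(\<integral>\<^sup>+x. ennreal (f (x + t)) \<partial>circle_measure) = (\<integral>\<^sup>+x. ennreal (f x) \<partial>circle_measure)"
    by (rule nn_integral_circle_shift) (simp_all add: per)
  then show ?thesis
    by (simp add: integral_eq_nn_integral nonneg measurable_circle_measure)
qed

lemma integrable_circle_bounded:
  fixes f :: "real \<Rightarrow> 'a::{banach, second_countable_topology}"
  assumes "f \<in> borel_measurable borel" "\<And>x. norm (f x) \<le> B"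
  shows "integrable circle_measure f"
  using assms by (intro finite_measure.integrable_const_bound[OF finite_measure_circle_measure, of _ B])
    (auto intro: measurable_circle_measure)

section \<open>Iterates of a cocycle\<close>

text \<open>The tangent space of SU(2), translated back to the identity. Differentiating the
  equations of \<open>SU2_iff\<close> shows that \<open>D\<close> has the same symmetric shape as
  \<open>f x\<close>, and the sphere equation makes the diagonal entry imaginary.\<close>

lemma vector_derivative_SU2_in_su2:
  assumes f: "\<And>x. f x \<in> SU2" and f': "(f has_vector_derivative D) (at x)"
  shows "D ** conj_transpose (f x) \<in> su2"
proof -
  have nth: "((\<lambda>x. f x $ i $ j) has_vector_derivative D $ i $ j) (at x)" for i j
    using bounded_linear.has_vector_derivative[OF bounded_linear_compose[OF bounded_linear_vec_nth
          bounded_linear_vec_nth, of i j] f'] by (simp add: o_def)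
  note nth_cnj = bounded_linear.has_vector_derivative[OF bounded_linear_cnj nth]
  have f22: "f y $ 2 $ 2 = cnj (f y $ 1 $ 1)" and f21: "f y $ 2 $ 1 = - cnj (f y $ 1 $ 2)"
    and f1: "f y $ 1 $ 1 * cnj (f y $ 1 $ 1) + f y $ 1 $ 2 * cnj (f y $ 1 $ 2) = 1" for y
    using f[of y] by (auto simp: SU2_iff)
  have D22: "D $ 2 $ 2 = cnj (D $ 1 $ 1)"
    using vector_derivative_unique_at[OF nth[of 2 2]] nth_cnj[of 1 1] by (simp add: f22)
  have D21: "D $ 2 $ 1 = - cnj (D $ 1 $ 2)"
    using vector_derivative_unique_at[OF nth[of 2 1]]
      has_vector_derivative_minus[OF nth_cnj[of 1 2]] by (simp add: f21)
  have "((\<lambda>y. f y $ 1 $ 1 * cnj (f y $ 1 $ 1) + f y $ 1 $ 2 * cnj (f y $ 1 $ 2)) has_vector_derivative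
    (f x $ 1 $ 1 * cnj (D $ 1 $ 1) + D $ 1 $ 1 * cnj (f x $ 1 $ 1)) +
    (f x $ 1 $ 2 * cnj (D $ 1 $ 2) + D $ 1 $ 2 * cnj (f x $ 1 $ 2))) (at x)"
    by (intro has_vector_derivative_add has_vector_derivative_mult nth nth_cnj)
  then have "(f x $ 1 $ 1 * cnj (D $ 1 $ 1) + D $ 1 $ 1 * cnj (f x $ 1 $ 1)) +
    (f x $ 1 $ 2 * cnj (D $ 1 $ 2) + D $ 1 $ 2 * cnj (f x $ 1 $ 2)) = 0"
    unfolding f1 using vector_derivative_unique_at has_vector_derivative_const by blast
  then have "cnj ((D ** conj_transpose (f x)) $ 1 $ 1) + (D ** conj_transpose (f x)) $ 1 $ 1 = 0"
    by (simp add: matrix_matrix_mult_def sum_2 algebra_simps)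
  then have 1: "cnj ((D ** conj_transpose (f x)) $ 1 $ 1) = - (D ** conj_transpose (f x)) $ 1 $ 1"
    by (simp add: eq_neg_iff_add_eq_0)
  have 2: "(D ** conj_transpose (f x)) $ 2 $ 2 = cnj ((D ** conj_transpose (f x)) $ 1 $ 1)"
    by (simp add: matrix_matrix_mult_def sum_2 f22 f21 D22 D21)
  have "(D ** conj_transpose (f x)) $ 2 $ 1 = - cnj ((D ** conj_transpose (f x)) $ 1 $ 2)"
    by (simp add: matrix_matrix_mult_def sum_2 f22 f21 D22 D21)
  with 1 2 show ?thesis
    by (simp add: su2_iff)
qed

lemma has_vector_derivative_shift:
  fixes x c :: real
  assumes "(f has_vector_derivative D) (at (x + c))"
  shows "((\<lambda>y. f (y + c)) has_vector_derivative D) (at x)"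
proof -
  have "((\<lambda>y. y + c) has_vector_derivative 1) (at x)"
    by (auto intro!: derivative_eq_intros)
  from vector_diff_chain_at[OF this assms] show ?thesis
    by (simp add: o_def)
qed

lemma norm_average_le:
  fixes f :: "nat \<Rightarrow> 'b::real_normed_vector"
  assumes "\<And>k. norm (f k) \<le> B" "0 \<le> B"
  shows "norm ((1 / real n) *\<^sub>R (\<Sum>k<n. f k)) \<le> B"
proof -
  have "norm (\<Sum>k<n. f k) \<le> real n * B"
    using sum_norm_bound[of "{..<n}" f B] assms(1) by simp
  then show ?thesis
    using assms(2) by (cases "n = 0") (auto simp: field_simps)
qed

locale SU2_cocycle =
  fixes \<alpha> :: real and \<phi> :: "real \<Rightarrow> complex^2^2"
  assumes cocycle: "C2_cocycle \<phi>"
begin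

abbreviation iter :: "nat \<Rightarrow> real \<Rightarrow> complex^2^2" where
  "iter \<equiv> cocycle_iter \<alpha> \<phi>"

abbreviation lderiv :: "real \<Rightarrow> complex^2^2" where
  "lderiv \<equiv> log_deriv \<phi>"

text \<open>The \<open>n\<close>-th power of the isometry of functions induced by the cocycle: the
  value at the \<open>n\<close>-th orbit point is brought back to \<open>x\<close> by the adjoint
  action. \<open>twist_add\<close> is the semigroup law.\<close>

definition twist :: "nat \<Rightarrow> (real \<Rightarrow> complex^2^2) \<Rightarrow> real \<Rightarrow> complex^2^2" where
  "twist n g x = iter n x ** g (x + real n * \<alpha>) ** conj_transpose (iter n x)"

text \<open>Birkhoff average of \<open>g\<close> under the twisted translation, with value 0 for
  \<open>n = 0\<close>. For \<open>g = lderiv\<close> it is the normalised logarithmic derivative of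
  the \<open>n\<close>-th iterate, by \<open>log_deriv_iter\<close>.\<close>

definition mean :: "nat \<Rightarrow> (real \<Rightarrow> complex^2^2) \<Rightarrow> real \<Rightarrow> complex^2^2" where
  "mean n g x = (1 / real n) *\<^sub>R (\<Sum>k<n. twist k g x)"

abbreviation avg :: "nat \<Rightarrow> real \<Rightarrow> complex^2^2" where
  "avg n \<equiv> mean n lderiv"

lemma SU2: "\<phi> x \<in> SU2" and periodic: "\<phi> (x + 1) = \<phi> x"
  using cocycle by (auto simp: C2_cocycle_def)

lemma rotation_funpow: "(rotation \<alpha> ^^ n) x = x + real n * \<alpha>"
  by (induction n) (simp_all add: rotation_def algebra_simps)

lemma iter_Suc: "iter (Suc n) x = iter n x ** \<phi> (x + real n * \<alpha>)"
  by (simp add: rotation_funpow)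

declare cocycle_iter.simps(2) [simp del]

lemma iter_SU2: "iter n x \<in> SU2"
  by (induction n) (simp_all add: iter_Suc SU2_mult SU2)

lemma iter_periodic: "iter n (x + 1) = iter n x"
proof (induction n)
  case (Suc n)
  then show ?case
    using periodic[of "x + real n * \<alpha>"] by (simp add: iter_Suc algebra_simps)
qed simp

lemma iter_add: "iter (m + n) x = iter m x ** iter n (x + real m * \<alpha>)"
  by (induction n) (simp_all add: iter_Suc matrix_mul_assoc algebra_simps)

lemma twist_add: "twist m (twist n g) x = twist (m + n) g x"
  by (simp add: twist_def iter_add conj_transpose_mult matrix_mul_assoc algebra_simps)

lemma norm_twist: "norm (twist n g x) = norm (g (x + real n * \<alpha>))"
  by (simp add: twist_def norm_SU2_mult_left norm_SU2_mult_right conj_transpose_SU2 iter_SU2)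

lemma twist_scaleR: "twist n (\<lambda>x. c *\<^sub>R f x) x = c *\<^sub>R twist n f x"
  by (simp add: twist_def matrix_mult.scaleR_left matrix_mult.scaleR_right)

lemma twist_sum: "twist n (\<lambda>x. \<Sum>i\<in>I. f i x) x = (\<Sum>i\<in>I. twist n (f i) x)"
  by (simp add: twist_def matrix_mult.sum_left matrix_mult.sum_right)

lemma obtain_derivative:
  obtains \<phi>' where "\<And>x. (\<phi> has_vector_derivative \<phi>' x) (at x)" "continuous_on UNIV \<phi>'"
proof -
  obtain f' f'' where "\<forall>x. (\<phi> has_vector_derivative f' x) (at x)"
     "\<forall>x. (f' has_vector_derivative f'' x) (at x)"
    using cocycle unfolding C2_cocycle_def C2_fun_def by metis
  then show ?thesis
    using that has_vector_derivative_continuous continuous_at_imp_continuous_on by metis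
qed

lemma has_vector_derivative: "(\<phi> has_vector_derivative lderiv x ** \<phi> x) (at x)"
proof -
  obtain \<phi>' where "(\<phi> has_vector_derivative \<phi>' x) (at x)"
    using obtain_derivative by metis
  moreover from this have "lderiv x ** \<phi> x = \<phi>' x"
    by (simp add: log_deriv_def matrix_inv_SU2 SU2 vector_derivative_at SU2_mult_conj_transpose
        flip: matrix_mul_assoc)
  ultimately show ?thesis by simp
qed

lemma lderiv_eq: "lderiv x = vector_derivative \<phi> (at x) ** conj_transpose (\<phi> x)"
  by (simp add: log_deriv_def matrix_inv_SU2 SU2)

lemma lderiv_su2: "lderiv x \<in> su2"
  unfolding lderiv_eq
  using vector_derivative_SU2_in_su2[OF SU2 has_vector_derivative]
    vector_derivative_at[OF has_vector_derivative] by simp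

lemma continuous_on_phi: "continuous_on UNIV \<phi>"
  using has_vector_derivative has_vector_derivative_continuous continuous_at_imp_continuous_on by metis

lemma continuous_on_lderiv: "continuous_on UNIV lderiv"
proof -
  obtain \<phi>' where d: "\<And>x. (\<phi> has_vector_derivative \<phi>' x) (at x)" "continuous_on UNIV \<phi>'"
    using obtain_derivative by metis
  have "lderiv = (\<lambda>x. \<phi>' x ** conj_transpose (\<phi> x))"
    using vector_derivative_at[OF d(1)] by (auto simp: lderiv_eq)
  then show ?thesis
    by (simp add: matrix_mult.continuous_on d bounded_linear.continuous_on[OF bounded_linear_conj_transpose]
        continuous_on_phi)
qed

lemma lderiv_periodic: "lderiv (x + 1) = lderiv x"
proof -
  have "((\<lambda>y. \<phi> (y + 1)) has_vector_derivative lderiv (x + 1) ** \<phi> (x + 1)) (at x)"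
    by (intro has_vector_derivative_shift has_vector_derivative)
  then have "lderiv (x + 1) ** \<phi> x = lderiv x ** \<phi> x"
    unfolding periodic using has_vector_derivative vector_derivative_unique_at by blast
  then have "lderiv (x + 1) ** \<phi> x ** conj_transpose (\<phi> x) = lderiv x ** \<phi> x ** conj_transpose (\<phi> x)"
    by simp
  then show ?thesis
    by (simp add: SU2 SU2_mult_conj_transpose flip: matrix_mul_assoc)
qed

lemma obtain_bound:
  obtains B where "B > 0" "\<And>x. norm (lderiv x) \<le> B"
proof -
  have "bounded (lderiv ` {0..1})"
    by (intro compact_imp_bounded compact_continuous_image continuous_on_subset[OF continuous_on_lderiv]) auto
  then obtain B where B: "B > 0" "\<And>x. x \<in> {0..1} \<Longrightarrow> norm (lderiv x) \<le> B"
    unfolding bounded_pos by auto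
  have "norm (lderiv x) \<le> B" for x
  proof -
    have "lderiv x = lderiv (frac x)"
      using periodic_int[of lderiv "frac x" "\<lfloor>x\<rfloor>", OF lderiv_periodic] by (simp add: frac_def)
    then show ?thesis using B(2)[of "frac x"] by (simp add: frac_ge_0 frac_lt_1 less_imp_le)
  qed
  with B(1) show ?thesis using that by blast
qed

text \<open>Product rule: the logarithmic derivative of the \<open>k\<close>-th factor is conjugated
  by the product of the factors before it, which gives the \<open>k\<close>-th twist.\<close>

lemma iter_has_vector_derivative:
  "(iter n has_vector_derivative (\<Sum>k<n. twist k lderiv x) ** iter n x) (at x)"
proof (induction n)
  case 0
  have "iter 0 = (\<lambda>_. mat 1)" by auto
  then show ?case by simp
next
  case (Suc n)
  have "((\<lambda>y. \<phi> (y + real n * \<alpha>)) has_vector_derivative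
      lderiv (x + real n * \<alpha>) ** \<phi> (x + real n * \<alpha>)) (at x)"
    by (intro has_vector_derivative_shift has_vector_derivative)
  from matrix_mult.has_vector_derivative[OF Suc this]
  have "((\<lambda>y. iter n y ** \<phi> (y + real n * \<alpha>)) has_vector_derivative
     iter n x ** (lderiv (x + real n * \<alpha>) ** \<phi> (x + real n * \<alpha>)) +
     (\<Sum>k<n. twist k lderiv x) ** iter n x ** \<phi> (x + real n * \<alpha>)) (at x)" .
  moreover have "iter (Suc n) = (\<lambda>y. iter n y ** \<phi> (y + real n * \<alpha>))"
    by (auto simp: iter_Suc)
  moreover have "twist n lderiv x ** iter n x = iter n x ** lderiv (x + real n * \<alpha>)"
    by (simp add: twist_def SU2_mult_conj_transpose iter_SU2 flip: matrix_mul_assoc)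
  ultimately show ?case
    by (simp add: iter_Suc matrix_mult.add_left matrix_mul_assoc add.commute)
qed

lemma log_deriv_iter: "log_deriv (iter n) x = (\<Sum>k<n. twist k lderiv x)"
  using vector_derivative_at[OF iter_has_vector_derivative, of n x]
  by (simp add: log_deriv_def matrix_inv_SU2 iter_SU2 SU2_mult_conj_transpose flip: matrix_mul_assoc)

lemma continuous_on_iter: "continuous_on UNIV (iter n)"
  using iter_has_vector_derivative has_vector_derivative_continuous continuous_at_imp_continuous_on by metis

lemma continuous_on_twist:
  assumes "continuous_on UNIV g"
  shows "continuous_on UNIV (twist n g)"
proof -
  have "continuous_on UNIV (\<lambda>x. g (x + real n * \<alpha>))"
    by (rule continuous_on_compose2[OF assms]) (auto intro!: continuous_intros)
  then show ?thesis
    unfolding twist_def[abs_def]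
    by (intro matrix_mult.continuous_on bounded_linear.continuous_on[OF bounded_linear_conj_transpose] continuous_on_iter)
qed

lemma twist_periodic:
  assumes "\<And>x. g (x + 1) = g x"
  shows "twist n g (x + 1) = twist n g x"
  unfolding twist_def iter_periodic using assms[of "x + real n * \<alpha>"] by (simp add: add_ac)

lemma continuous_on_avg: "continuous_on UNIV (avg n)"
  unfolding mean_def[abs_def]
  by (intro continuous_intros continuous_on_twist continuous_on_lderiv)

lemma avg_measurable [measurable]: "avg n \<in> borel_measurable borel"
  by (rule borel_measurable_continuous_onI[OF continuous_on_avg])

lemma avg_periodic: "avg n (x + 1) = avg n x"
  by (simp add: mean_def twist_periodic lderiv_periodic)

lemma avg_su2: "avg n x \<in> su2"
  unfolding mean_def twist_def
  by (intro su2_scaleR su2_sum su2_conjugate iter_SU2 lderiv_su2)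

lemma norm_avg_le:
  assumes "\<And>x. norm (lderiv x) \<le> B" "0 \<le> B"
  shows "norm (avg n x) \<le> B"
  unfolding mean_def by (rule norm_average_le) (simp_all add: norm_twist assms)

end

section \<open>The mean ergodic theorem\<close>

text \<open>Moving the window by one step exchanges only two terms, so a shift by \<open>i\<close>
  costs at most \<open>2 * i\<close> of them.\<close>

lemma norm_sum_shift_le:
  fixes t :: "nat \<Rightarrow> 'a::real_normed_vector"
  assumes "\<And>j. norm (t j) \<le> B"
  shows "norm ((\<Sum>j<k. t (j + i)) - (\<Sum>j<k. t j)) \<le> 2 * real i * B"
proof (induction i)
  case (Suc i)
  have "(\<Sum>j<k. t (j + Suc i)) - (\<Sum>j<k. t (j + i)) = t (k + i) - t i"
    using sum_lessThan_telescope[of "\<lambda>j. t (j + i)" k] by (simp add: sum_subtractf)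
  then have "(\<Sum>j<k. t (j + Suc i)) - (\<Sum>j<k. t j) =
      ((\<Sum>j<k. t (j + i)) - (\<Sum>j<k. t j)) + (t (k + i) - t i)"
    by (simp add: algebra_simps)
  also have "norm \<dots> \<le> 2 * real i * B + (B + B)"
    by (intro norm_triangle_mono Suc norm_triangle_le_diff add_mono assms)
  finally show ?case by (simp add: algebra_simps)
qed simp

lemma norm_diff_power2_le:
  fixes u v :: "'a::real_normed_vector"
  assumes "norm (u - v) \<le> e" "norm u \<le> B" "norm v \<le> B"
  shows "(norm v)\<^sup>2 \<le> (norm u)\<^sup>2 + 2 * B * e"
proof -
  have "(norm v)\<^sup>2 - (norm u)\<^sup>2 = (norm v - norm u) * (norm v + norm u)"
    by (simp add: power2_eq_square algebra_simps)
  also have "\<dots> \<le> e * (2 * B)"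
  proof (rule order_trans[OF mult_right_mono mult_left_mono])
    show "norm v - norm u \<le> e"
      using assms(1) norm_triangle_ineq2[of v u] by (simp add: norm_minus_commute)
    show "0 \<le> e" using assms(1) norm_ge_zero order_trans by blast
  qed (use assms in auto)
  finally show ?thesis by (simp add: mult.commute)
qed

text \<open>Triangle inequality followed by Cauchy-Schwarz.\<close>

lemma norm_average_power2_le:
  fixes f :: "nat \<Rightarrow> 'b::real_normed_vector"
  shows "(norm ((1 / real n) *\<^sub>R (\<Sum>k<n. f k)))\<^sup>2 \<le> (1 / real n) * (\<Sum>k<n. (norm (f k))\<^sup>2)"
proof (cases "n = 0")
  case False
  have "(norm (\<Sum>k<n. f k))\<^sup>2 \<le> (\<Sum>k<n. norm (f k))\<^sup>2"
    by (intro power_mono norm_sum norm_ge_zero)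
  also have "\<dots> \<le> (\<Sum>k<n. (norm (f k))\<^sup>2) * real n"
    using sum_squared_le_sum_of_squares[of "\<lambda>k. norm (f k)" "{..<n}"] by simp
  finally show ?thesis
    using False by (simp add: power_divide divide_simps power2_eq_square)
qed simp

context SU2_cocycle
begin

text \<open>A canonical constant, so that all uniform estimates below refer to the same bound. The
  supremum is meaningful because \<open>lderiv\<close> is continuous and periodic.\<close>

definition bound :: real where
  "bound = (SUP x. norm (lderiv x))"

lemma norm_lderiv_le: "norm (lderiv x) \<le> bound"
proof -
  obtain B where "\<And>x. norm (lderiv x) \<le> B"
    using obtain_bound by blast
  then show ?thesis
    unfolding bound_def by (intro cSUP_upper) (auto intro!: bdd_aboveI)
qed

lemma bound_nonneg: "0 \<le> bound"
  using norm_lderiv_le norm_ge_zero order_trans by blast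

lemma norm_avg_le_bound: "norm (avg n x) \<le> bound"
  by (intro norm_avg_le norm_lderiv_le bound_nonneg)

lemma mean_add: "mean n (\<lambda>x. f x + g x) x = mean n f x + mean n g x"
  by (simp add: mean_def twist_def matrix_mult.add_left matrix_mult.add_right sum.distrib scaleR_add_right)

lemma mean_scaleR: "mean n (\<lambda>x. c *\<^sub>R f x) x = c *\<^sub>R mean n f x"
  by (simp add: mean_def twist_scaleR mult.commute flip: scaleR_sum_right)

text \<open>An average of averages is the mean over \<open>i < n\<close> of the length
  \<open>k\<close> windows shifted by \<open>i\<close>. Each differs from the unshifted window only
  in boundary terms, which are negligible once \<open>k\<close> is large compared with
  \<open>n\<close>.\<close>

lemma norm_mean_avg_diff_le:
  assumes "0 < n" "0 < k"
  shows "norm (mean k (avg n) x - avg k x) \<le> 2 * real n * bound / real k"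
proof -
  define t where "t j = twist j lderiv x" for j
  have nt: "norm (t j) \<le> bound" for j
    by (simp add: t_def norm_twist norm_lderiv_le)
  have tw: "twist j (avg n) x = (1 / real n) *\<^sub>R (\<Sum>i<n. t (j + i))" for j
    unfolding mean_def twist_scaleR twist_sum twist_add t_def ..
  have "mean k (avg n) x = (1 / real k) *\<^sub>R (1 / real n) *\<^sub>R (\<Sum>i<n. \<Sum>j<k. t (j + i))"
    unfolding mean_def[of k "avg n"] tw by (subst sum.swap) (simp flip: scaleR_sum_right)
  moreover have "avg k x = (1 / real k) *\<^sub>R (1 / real n) *\<^sub>R (\<Sum>i<n. \<Sum>j<k. t j)"
    using assms by (simp add: mean_def t_def sum_constant_scaleR del: sum_constant)
  ultimately have "mean k (avg n) x - avg k x =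
      (1 / real k) *\<^sub>R (1 / real n) *\<^sub>R (\<Sum>i<n. (\<Sum>j<k. t (j + i)) - (\<Sum>j<k. t j))"
    by (simp add: sum_subtractf scaleR_diff_right)
  also have "norm \<dots> \<le> (1 / real k) * (2 * real n * bound)"
    unfolding norm_scaleR
  proof (rule mult_mono)
    have "norm ((1 / real n) *\<^sub>R (\<Sum>i<n. (\<Sum>j<k. t (j + i)) - (\<Sum>j<k. t j))) =
        norm (\<Sum>i<n. (\<Sum>j<k. t (j + i)) - (\<Sum>j<k. t j)) / real n"
      by simp
    also have "\<dots> \<le> (real n * (2 * real n * bound)) / real n"
    proof (rule divide_right_mono)
      have "norm (\<Sum>i<n. (\<Sum>j<k. t (j + i)) - (\<Sum>j<k. t j)) \<le> real (card {..<n}) * (2 * real n * bound)"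
      proof (rule sum_norm_bound)
        fix i assume "i \<in> {..<n}"
        then have "2 * real i * bound \<le> 2 * real n * bound"
          by (intro mult_right_mono bound_nonneg) simp
        with norm_sum_shift_le[of t bound i k, OF nt]
        show "norm ((\<Sum>j<k. t (j + i)) - (\<Sum>j<k. t j)) \<le> 2 * real n * bound"
          by simp
      qed
      then show "norm (\<Sum>i<n. (\<Sum>j<k. t (j + i)) - (\<Sum>j<k. t j)) \<le> real n * (2 * real n * bound)"
        by simp
    qed simp
    finally show "\<bar>1 / real n\<bar> * norm (\<Sum>i<n. (\<Sum>j<k. t (j + i)) - (\<Sum>j<k. t j)) \<le> 2 * real n * bound"
      using assms by simp
  qed simp_all
  finally show ?thesis by simp
qed

text \<open>Averaging is an \<open>L\<^sup>2\<close> contraction: Cauchy-Schwarz holds pointwise,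
  and each translate has the same integral as \<open>g\<close>.\<close>

lemma integral_norm_mean_power2_le:
  assumes [measurable]: "g \<in> borel_measurable borel" and per: "\<And>x. g (x + 1) = g x"
    and B: "\<And>x. norm (g x) \<le> B"
    and [measurable]: "mean k g \<in> borel_measurable borel"
  shows "(\<integral>x. (norm (mean k g x))\<^sup>2 \<partial>circle_measure) \<le> (\<integral>x. (norm (g x))\<^sup>2 \<partial>circle_measure)"
proof -
  have int: "integrable circle_measure (\<lambda>x. (norm (g (x + c)))\<^sup>2)" for c
    by (rule integrable_circle_bounded[where B = "B\<^sup>2"]) (auto intro!: power_mono B)
  have eq: "(\<integral>x. (norm (g (x + c)))\<^sup>2 \<partial>circle_measure) = (\<integral>x. (norm (g x))\<^sup>2 \<partial>circle_measure)" for c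
    by (rule integral_circle_shift) (simp_all add: per)
  have "(\<integral>x. (norm (mean k g x))\<^sup>2 \<partial>circle_measure) \<le>
      (\<integral>x. (1 / real k) * (\<Sum>j<k. (norm (g (x + real j * \<alpha>)))\<^sup>2) \<partial>circle_measure)"
  proof (rule integral_mono')
    show "integrable circle_measure (\<lambda>x. (1 / real k) * (\<Sum>j<k. (norm (g (x + real j * \<alpha>)))\<^sup>2))"
      by (intro integrable_mult_right Bochner_Integration.integrable_sum int)
    show "(norm (mean k g x))\<^sup>2 \<le> 1 / real k * (\<Sum>j<k. (norm (g (x + real j * \<alpha>)))\<^sup>2)" for x
      using norm_average_power2_le[of k "\<lambda>j. twist j g x"] by (simp add: mean_def norm_twist)
  qed (auto intro!: divide_nonneg_nonneg sum_nonneg)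
  also have "\<dots> = (1 / real k) * (\<Sum>j<k. (\<integral>x. (norm (g x))\<^sup>2 \<partial>circle_measure))"
    by (simp only: integral_mult_right_zero Bochner_Integration.integral_sum int eq)
  also have "\<dots> \<le> (\<integral>x. (norm (g x))\<^sup>2 \<partial>circle_measure)"
    by (cases "k = 0") auto
  finally show ?thesis .
qed

text \<open>Combines the contraction property with a uniform error \<open>e\<close>. It is applied
  to single averages and to midpoints of two averages, whose \<open>k\<close>-th means are both
  close to \<open>avg k\<close>.\<close>

lemma integral_norm_avg_power2_le:
  assumes g: "continuous_on UNIV g" and per: "\<And>x. g (x + 1) = g x"
    and B: "\<And>x. norm (g x) \<le> bound" and e: "\<And>x. norm (mean k g x - avg k x) \<le> e"
  shows "(\<integral>x. (norm (avg k x))\<^sup>2 \<partial>circle_measure) \<le> (\<integral>x. (norm (g x))\<^sup>2 \<partial>circle_measure) + 2 * bound * e"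
proof -
  have mB: "norm (mean k g x) \<le> bound" for x
    unfolding mean_def by (rule norm_average_le) (simp_all add: norm_twist B bound_nonneg)
  have "continuous_on UNIV (mean k g)"
    unfolding mean_def[abs_def] by (intro continuous_intros continuous_on_twist g)
  then have [measurable]: "g \<in> borel_measurable borel" "mean k g \<in> borel_measurable borel"
    using g by (auto intro: borel_measurable_continuous_onI)
  have int: "integrable circle_measure (\<lambda>x. (norm (mean k g x))\<^sup>2)"
    by (rule integrable_circle_bounded[where B = "bound\<^sup>2"]) (auto intro!: power_mono mB)
  have "(\<integral>x. (norm (avg k x))\<^sup>2 \<partial>circle_measure) \<le>
      (\<integral>x. (norm (mean k g x))\<^sup>2 + 2 * bound * e \<partial>circle_measure)"
  proof (rule integral_mono)
    show "integrable circle_measure (\<lambda>x. (norm (avg k x))\<^sup>2)"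
      by (rule integrable_circle_bounded[where B = "bound\<^sup>2"]) (auto intro!: power_mono norm_avg_le_bound)
    show "integrable circle_measure (\<lambda>x. (norm (mean k g x))\<^sup>2 + 2 * bound * e)"
      by (intro Bochner_Integration.integrable_add int
          finite_measure.integrable_const finite_measure_circle_measure)
  qed (intro norm_diff_power2_le e mB norm_avg_le_bound)
  also have "\<dots> = (\<integral>x. (norm (mean k g x))\<^sup>2 \<partial>circle_measure) + 2 * bound * e"
    using int by (subst Bochner_Integration.integral_add)
      (auto intro!: finite_measure.integrable_const finite_measure_circle_measure)
  also have "\<dots> \<le> (\<integral>x. (norm (g x))\<^sup>2 \<partial>circle_measure) + 2 * bound * e"
    using integral_norm_mean_power2_le[of g bound k] per B by auto
  finally show ?thesis .
qed

text \<open>The squared norms of the averages converge to their infimum, and a midpoint of two averages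
  cannot have a smaller norm than that infimum, so the parallelogram law gives the Cauchy
  property.\<close>

lemma avg_L2_Cauchy:
  assumes "\<epsilon> > 0"
  shows "\<exists>N. \<forall>i\<ge>N. \<forall>j\<ge>N. (\<integral>x. (norm (avg i x - avg j x))\<^sup>2 \<partial>circle_measure) < \<epsilon>"
proof -
  define a where "a n = (\<integral>x. (norm (avg n x))\<^sup>2 \<partial>circle_measure)" for n
  define m where "m = (INF n\<in>{0<..}. a n)"
  have a0: "0 \<le> a n" for n by (simp add: a_def)
  have bdd: "bdd_below (a ` {0<..})"
    by (rule bdd_belowI2[of _ 0]) (simp add: a0)
  have m_le: "m \<le> a n" if "n > 0" for n
    unfolding m_def using that bdd by (intro cINF_lower) auto
  \<comment> \<open>For fixed \<open>n\<close> the error vanishes as \<open>k\<close> grows, so each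
    \<open>a n\<close> is asymptotically an upper bound for all later \<open>a k\<close>.\<close>
  have ev: "a k \<le> a n + 2 * bound * (2 * real n * bound / real k)" if "0 < n" "0 < k" for n k
    unfolding a_def
    by (intro integral_norm_avg_power2_le continuous_on_avg avg_periodic norm_avg_le_bound
        norm_mean_avg_diff_le that)
  \<comment> \<open>The \<open>k\<close>-th mean of the midpoint is also close to
    \<open>avg k\<close>. Letting \<open>k\<close> tend to infinity puts \<open>m\<close>, a lower
    bound of every \<open>a k\<close> with \<open>k > 0\<close>, below the squared norm of the
    midpoint.\<close>
  have mid: "m \<le> (\<integral>x. (norm ((1/2) *\<^sub>R (avg i x + avg j x)))\<^sup>2 \<partial>circle_measure)" (is "_ \<le> ?I")
    if "0 < i" "0 < j" for i j
  proof -
    define c where "c = real i + real j"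
    have "a k \<le> ?I + 2 * bound * (c * bound / real k)" if "k > 0" for k
      unfolding a_def
    proof (rule integral_norm_avg_power2_le)
      show "continuous_on UNIV (\<lambda>x. (1/2) *\<^sub>R (avg i x + avg j x))"
        by (intro continuous_intros continuous_on_avg)
      fix x
      show "(1/2) *\<^sub>R (avg i (x + 1) + avg j (x + 1)) = (1/2) *\<^sub>R (avg i x + avg j x)"
        by (simp add: avg_periodic)
      have "norm (avg i x + avg j x) \<le> bound + bound"
        by (intro norm_triangle_mono norm_avg_le_bound)
      then show "norm ((1/2) *\<^sub>R (avg i x + avg j x)) \<le> bound" by simp
      have "mean k (\<lambda>x. (1/2) *\<^sub>R (avg i x + avg j x)) x = (1/2) *\<^sub>R (mean k (avg i) x + mean k (avg j) x)"
        by (simp only: mean_scaleR mean_add)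
      then have "mean k (\<lambda>x. (1/2) *\<^sub>R (avg i x + avg j x)) x - avg k x =
          (1/2) *\<^sub>R ((mean k (avg i) x - avg k x) + (mean k (avg j) x - avg k x))"
        by (simp add: scaleR_add_right scaleR_diff_right)
      moreover have "norm ((mean k (avg i) x - avg k x) + (mean k (avg j) x - avg k x)) \<le>
          2 * real i * bound / real k + 2 * real j * bound / real k"
        by (intro norm_triangle_mono norm_mean_avg_diff_le \<open>0 < i\<close> \<open>0 < j\<close> \<open>0 < k\<close>)
      ultimately have "norm (mean k (\<lambda>x. (1/2) *\<^sub>R (avg i x + avg j x)) x - avg k x) \<le>
          (1/2) * (2 * real i * bound / real k + 2 * real j * bound / real k)"
        by (simp only: norm_scaleR) simp
      also have "\<dots> = c * bound / real k"
        by (simp add: c_def add_divide_distrib distrib_right)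
      finally show "norm (mean k (\<lambda>x. (1/2) *\<^sub>R (avg i x + avg j x)) x - avg k x) \<le> c * bound / real k" .
    qed
    then have "m \<le> ?I + 2 * bound * (c * bound / real (Suc k))" for k
      by (rule order_trans[OF m_le[OF zero_less_Suc]]) (rule zero_less_Suc)
    moreover have "(\<lambda>k. ?I + 2 * bound * (c * bound / real (Suc k))) \<longlonglongrightarrow> ?I + 2 * bound * 0"
      by (intro tendsto_intros LIMSEQ_Suc[OF lim_const_over_n])
    ultimately show ?thesis
      using LIMSEQ_le_const[of _ ?I m] by simp
  qed
  \<comment> \<open>A near-minimiser \<open>n\<close>: by \<open>ev\<close> it forces every late
    \<open>a k\<close> below \<open>m + \<epsilon> / 4\<close>.\<close>
  have "\<exists>n>0. a n < m + \<epsilon> / 8"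
    using cINF_less_iff[OF _ bdd, of "m + \<epsilon> / 8"] assms by (auto simp: m_def[symmetric])
  then obtain n where n: "n > 0" "a n < m + \<epsilon> / 8" by blast
  have "(\<lambda>k. 2 * bound * (2 * real n * bound / real k)) \<longlonglongrightarrow> 2 * bound * 0"
    by (intro tendsto_intros lim_const_over_n)
  then have "\<forall>\<^sub>F k in sequentially. 2 * bound * (2 * real n * bound / real k) < \<epsilon> / 8"
    using assms by (intro order_tendstoD) auto
  then obtain N where N: "\<And>k. k \<ge> N \<Longrightarrow> 2 * bound * (2 * real n * bound / real k) < \<epsilon> / 8"
    by (auto simp: eventually_sequentially)
  have small: "a k < m + \<epsilon> / 4" if "k \<ge> Suc N" for k
    using ev[OF n(1), of k] n(2) N[of k] that by simp
  have "(\<integral>x. (norm (avg i x - avg j x))\<^sup>2 \<partial>circle_measure) < \<epsilon>" if ij: "i \<ge> Suc N" "j \<ge> Suc N" for i j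
  proof -
    have int: "integrable circle_measure (\<lambda>x. (norm (avg k x))\<^sup>2)" for k
      by (rule integrable_circle_bounded[where B = "bound\<^sup>2"]) (auto intro!: power_mono norm_avg_le_bound)
    have int2: "integrable circle_measure (\<lambda>x. (norm ((1/2) *\<^sub>R (avg i x + avg j x)))\<^sup>2)"
    proof (rule integrable_circle_bounded[where B = "bound\<^sup>2"])
      fix x
      have "norm (avg i x + avg j x) \<le> bound + bound"
        by (intro norm_triangle_mono norm_avg_le_bound)
      then show "norm ((norm ((1/2) *\<^sub>R (avg i x + avg j x)))\<^sup>2) \<le> bound\<^sup>2"
        by (auto intro!: power_mono)
    qed simp
    \<comment> \<open>Parallelogram law. With both squared norms below
      \<open>m + \<epsilon> / 4\<close> and the midpoint at least \<open>m\<close>, the terms in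
      \<open>m\<close> cancel and exactly \<open>\<epsilon>\<close> remains.\<close>
    have par: "(norm (u - v))\<^sup>2 = 2 * (norm u)\<^sup>2 + 2 * (norm v)\<^sup>2 - 4 * (norm ((1/2) *\<^sub>R (u + v)))\<^sup>2"
      for u v :: "complex^2^2"
      unfolding dot_square_norm[symmetric] by (simp add: inner_simps inner_commute field_simps)
    have "(\<integral>x. (norm (avg i x - avg j x))\<^sup>2 \<partial>circle_measure) =
      2 * a i + 2 * a j - 4 * (\<integral>x. (norm ((1/2) *\<^sub>R (avg i x + avg j x)))\<^sup>2 \<partial>circle_measure)"
      unfolding par a_def using int int2 by simp
    also have "\<dots> < \<epsilon>"
      using mid[of i j] small[of i] small[of j] ij by simp
    finally show ?thesis .
  qed
  then show ?thesis by blast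
qed

end

section \<open>From square means to means\<close>

lemma norm_diff_power2_le_2:
  fixes u v w :: "'b::real_normed_vector"
  shows "(norm (u - w))\<^sup>2 \<le> 2 * (norm (v - u))\<^sup>2 + 2 * (norm (v - w))\<^sup>2"
proof -
  have "norm (u - w) \<le> norm (v - u) + norm (v - w)"
    using norm_triangle_ineq4[of "v - w" "v - u"] by (simp add: add.commute)
  then have "(norm (u - w))\<^sup>2 \<le> (norm (v - u) + norm (v - w))\<^sup>2"
    by (intro power_mono norm_ge_zero)
  also have "\<dots> \<le> 2 * (norm (v - u))\<^sup>2 + 2 * (norm (v - w))\<^sup>2"
    using sum_squares_bound[of "norm (v - u)" "norm (v - w)"] by (simp add: power2_sum)
  finally show ?thesis .
qed

context SU2_cocycle
begin

lemma integrable_norm_diff_avg: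
  assumes [measurable]: "g \<in> borel_measurable borel" and B: "\<And>x. norm (g x) \<le> bound"
  shows "integrable circle_measure (\<lambda>x. norm (avg n x - g x))"
    "integrable circle_measure (\<lambda>x. (norm (avg n x - g x))\<^sup>2)"
proof -
  have le: "norm (avg n x - g x) \<le> 2 * bound" for x
    using norm_triangle_le_diff[OF add_mono[OF norm_avg_le_bound B], of n x x] by simp
  show "integrable circle_measure (\<lambda>x. norm (avg n x - g x))"
    by (rule integrable_circle_bounded[where B = "2 * bound"]) (simp_all add: le)
  show "integrable circle_measure (\<lambda>x. (norm (avg n x - g x))\<^sup>2)"
    by (rule integrable_circle_bounded[where B = "(2 * bound)\<^sup>2"])
      (simp, unfold real_norm_def abs_power2, intro power_mono le norm_ge_zero)
qed

text \<open>\<open>y \<le> y\<^sup>2 / e + e\<close> follows from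
  \<open>(y - e)\<^sup>2 \<ge> 0\<close>; it is integrated over a space of total mass 1.\<close>

lemma integral_norm_le_L2:
  assumes g: "g \<in> borel_measurable borel" "\<And>x. norm (g x) \<le> bound" and e: "e > 0"
    and le: "(\<integral>x. (norm (avg n x - g x))\<^sup>2 \<partial>circle_measure) \<le> e\<^sup>2"
  shows "(\<integral>x. norm (avg n x - g x) \<partial>circle_measure) \<le> 2 * e"
proof -
  note int = integrable_norm_diff_avg[OF g]
  have c: "integrable circle_measure (\<lambda>_. e)"
    by (intro finite_measure.integrable_const finite_measure_circle_measure)
  have "(\<integral>x. norm (avg n x - g x) \<partial>circle_measure) \<le>
      (\<integral>x. (norm (avg n x - g x))\<^sup>2 / e + e \<partial>circle_measure)"
  proof (rule integral_mono)
    show "integrable circle_measure (\<lambda>x. (norm (avg n x - g x))\<^sup>2 / e + e)"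
      by (intro Bochner_Integration.integrable_add integrable_divide int c)
    show "norm (avg n x - g x) \<le> (norm (avg n x - g x))\<^sup>2 / e + e" for x
    proof -
      define y where "y = norm (avg n x - g x)"
      have "0 \<le> (y - e)\<^sup>2" "0 \<le> y * e" using e by (simp_all add: y_def)
      then have "y * e \<le> y\<^sup>2 + e * e" by (simp add: power2_eq_square algebra_simps)
      then have "y \<le> y\<^sup>2 / e + e" using e by (simp add: field_simps)
      then show ?thesis by (simp add: y_def)
    qed
  qed (rule int)
  also have "\<dots> = (\<integral>x. (norm (avg n x - g x))\<^sup>2 \<partial>circle_measure) / e + e"
    using int(2)[of n] c by simp
  also have "\<dots> \<le> e\<^sup>2 / e + e"
    using le e by (intro add_right_mono divide_right_mono) auto
  finally show ?thesis using e by (simp add: power2_eq_square)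
qed

lemma avg_L1_Cauchy:
  assumes "\<epsilon> > 0"
  shows "\<exists>N. \<forall>i\<ge>N. \<forall>j\<ge>N. (\<integral>x. norm (avg i x - avg j x) \<partial>circle_measure) < \<epsilon>"
proof -
  have "(\<epsilon> / 3)\<^sup>2 > 0" using assms by simp
  from avg_L2_Cauchy[OF this] obtain N where N: "\<And>i j. i \<ge> N \<Longrightarrow> j \<ge> N \<Longrightarrow>
      (\<integral>x. (norm (avg i x - avg j x))\<^sup>2 \<partial>circle_measure) < (\<epsilon> / 3)\<^sup>2"
    by blast
  have "(\<integral>x. norm (avg i x - avg j x) \<partial>circle_measure) \<le> 2 * (\<epsilon> / 3)" if "i \<ge> N" "j \<ge> N" for i j
    using N[OF that] assms by (intro integral_norm_le_L2) (auto simp: norm_avg_le_bound)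
  then show ?thesis using assms by (intro exI[of _ N]) fastforce
qed

section \<open>The invariant limit function\<close>

lemma obtain_subsequence:
  obtains r where "strict_mono r" "AE x in circle_measure. convergent (\<lambda>i. avg (r i) x)"
proof -
  have "integrable circle_measure (avg n)" for n
    by (rule integrable_circle_bounded[where B = bound]) (simp_all add: norm_avg_le_bound)
  then obtain r where "strict_mono r" "AE x in circle_measure. Cauchy (\<lambda>i. avg (r i) x)"
    using cauchy_L1_AE_cauchy_subseq[of circle_measure avg, OF _ avg_L1_Cauchy] by blast
  then show ?thesis
    using that by (simp add: Cauchy_convergent_iff)
qed

definition subseq :: "nat \<Rightarrow> nat" where
  "subseq = (SOME r. strict_mono r \<and> (AE x in circle_measure. convergent (\<lambda>i. avg (r i) x)))"

text \<open>A function defined at every point, not a class modulo null sets. The value 0 off the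
  convergence set lies in \<open>su2\<close> and is fixed by conjugation, so periodicity, the bound
  and the invariance hold everywhere.\<close>

definition limit :: "real \<Rightarrow> complex^2^2" where
  "limit x = (if convergent (\<lambda>i. avg (subseq i) x) then lim (\<lambda>i. avg (subseq i) x) else 0)"

lemma strict_mono_subseq: "strict_mono subseq"
  and AE_convergent: "AE x in circle_measure. convergent (\<lambda>i. avg (subseq i) x)"
proof -
  have "\<exists>r. strict_mono r \<and> (AE x in circle_measure. convergent (\<lambda>i. avg (r i) x))"
    using obtain_subsequence by blast
  from someI_ex[OF this] show "strict_mono subseq" "AE x in circle_measure. convergent (\<lambda>i. avg (subseq i) x)"
    unfolding subseq_def[symmetric] by blast+
qed

lemma tendsto_limit: "convergent (\<lambda>i. avg (subseq i) x) \<Longrightarrow> (\<lambda>i. avg (subseq i) x) \<longlonglongrightarrow> limit x"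
  by (simp add: limit_def convergent_LIMSEQ_iff)

lemma limit_measurable [measurable]: "limit \<in> borel_measurable borel"
  unfolding limit_def[abs_def] Cauchy_convergent_iff[symmetric] by measurable

lemma limit_periodic: "limit (x + 1) = limit x"
  by (simp add: limit_def avg_periodic)

lemma limit_su2: "limit x \<in> su2"
proof (cases "convergent (\<lambda>i. avg (subseq i) x)")
  case True
  then show ?thesis
    using closed_sequentially[OF closed_su2 avg_su2 tendsto_limit] by blast
qed (simp add: limit_def)

lemma norm_limit_le: "norm (limit x) \<le> bound"
proof (cases "convergent (\<lambda>i. avg (subseq i) x)")
  case True
  have "(\<lambda>i. norm (avg (subseq i) x)) \<longlonglongrightarrow> norm (limit x)"
    by (intro tendsto_norm tendsto_limit True)
  then show ?thesis
    by (rule LIMSEQ_le_const2) (simp add: norm_avg_le_bound)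
qed (simp add: limit_def bound_nonneg)

text \<open>The two sums differ only in their first and last terms.\<close>

lemma norm_avg_twist_diff_le: "norm (avg n x - twist 1 (avg n) x) \<le> 2 * bound / real n"
proof -
  have "twist 1 (avg n) x = (1 / real n) *\<^sub>R (\<Sum>i<n. twist (i + 1) lderiv x)"
    unfolding mean_def twist_scaleR twist_sum twist_add by (simp add: add.commute)
  then have "norm (avg n x - twist 1 (avg n) x) =
      norm ((\<Sum>i<n. twist (i + 1) lderiv x) - (\<Sum>i<n. twist i lderiv x)) / real n"
    by (simp add: mean_def norm_minus_commute flip: scaleR_diff_right)
  also have "\<dots> \<le> (2 * real 1 * bound) / real n"
    by (intro divide_right_mono norm_sum_shift_le) (simp_all add: norm_twist norm_lderiv_le)
  finally show ?thesis by simp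
qed

lemma avg_twist_diff_tendsto: "(\<lambda>i. avg (subseq i) x - twist 1 (avg (subseq i)) x) \<longlonglongrightarrow> 0"
proof (rule tendsto_norm_zero_cancel, rule tendsto_sandwich[OF _ _ tendsto_const])
  show "(\<lambda>i. 2 * bound / real (subseq i)) \<longlonglongrightarrow> 0"
    using LIMSEQ_subseq_LIMSEQ[OF lim_const_over_n strict_mono_subseq] by (simp add: o_def)
qed (simp_all add: norm_avg_twist_diff_le del: One_nat_def)

text \<open>The averages at \<open>x\<close> and the conjugated averages at
  \<open>x + \<alpha>\<close> differ by a null sequence, and conjugation is invertible. So the
  subsequence converges at both points or at neither, and in the second case both sides are
  0.\<close>

lemma limit_twist_1: "limit x = \<phi> x ** limit (x + \<alpha>) ** conj_transpose (\<phi> x)"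
proof -
  have tw: "twist 1 g x = \<phi> x ** g (x + \<alpha>) ** conj_transpose (\<phi> x)" for g
    using iter_Suc[of 0] by (simp add: twist_def)
  note diff = avg_twist_diff_tendsto[of x, unfolded tw]
  have fwd: "(\<lambda>i. avg (subseq i) x) \<longlonglongrightarrow> \<phi> x ** l ** conj_transpose (\<phi> x)"
    if "(\<lambda>i. avg (subseq i) (x + \<alpha>)) \<longlonglongrightarrow> l" for l
    using tendsto_add[OF diff matrix_mult.tendsto[OF matrix_mult.tendsto[OF tendsto_const that] tendsto_const,
          of "\<phi> x" "conj_transpose (\<phi> x)"]] by simp
  have bwd: "(\<lambda>i. avg (subseq i) (x + \<alpha>)) \<longlonglongrightarrow> conj_transpose (\<phi> x) ** l ** \<phi> x"
    if "(\<lambda>i. avg (subseq i) x) \<longlonglongrightarrow> l" for l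
  proof -
    have "(\<lambda>i. \<phi> x ** avg (subseq i) (x + \<alpha>) ** conj_transpose (\<phi> x)) \<longlonglongrightarrow> l"
      using tendsto_diff[OF that diff] by simp
    then have "(\<lambda>i. conj_transpose (\<phi> x) ** (\<phi> x ** avg (subseq i) (x + \<alpha>) ** conj_transpose (\<phi> x)) ** \<phi> x)
        \<longlonglongrightarrow> conj_transpose (\<phi> x) ** l ** \<phi> x"
      by (intro matrix_mult.tendsto tendsto_const)
    moreover have "conj_transpose (\<phi> x) ** (\<phi> x ** Y ** conj_transpose (\<phi> x)) ** \<phi> x = Y" for Y
      using SU2_mult_conj_transpose(1)[OF SU2, of x] by (metis matrix_mul_assoc matrix_mul_lid matrix_mul_rid)
    ultimately show ?thesis by simp
  qed
  show ?thesis
  proof (cases "convergent (\<lambda>i. avg (subseq i) (x + \<alpha>))")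
    case True
    from fwd[OF tendsto_limit[OF this]] show ?thesis
      by (metis LIMSEQ_unique convergentI tendsto_limit)
  next
    case False
    then have "\<not> convergent (\<lambda>i. avg (subseq i) x)"
      using bwd by (metis convergent_def)
    with False show ?thesis by (simp add: limit_def)
  qed
qed

lemma twist_limit: "twist n limit x = limit x"
proof (induction n arbitrary: x)
  case (Suc n)
  have "twist (Suc n) limit x = twist n (twist 1 limit) x"
    by (simp add: twist_add)
  moreover have "twist 1 limit = limit"
    by (rule ext) (simp add: twist_def iter_Suc limit_twist_1[symmetric])
  ultimately show ?case using Suc by simp
qed (simp add: twist_def)

text \<open>Dominated convergence gives the limit along the subsequence; the Cauchy property extends
  it to the full sequence.\<close>

lemma avg_L2_limit: "(\<lambda>n. \<integral>x. (norm (avg n x - limit x))\<^sup>2 \<partial>circle_measure) \<longlonglongrightarrow> 0"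
proof -
  note int = integrable_norm_diff_avg(2)[OF limit_measurable norm_limit_le]
  have "(\<lambda>i. \<integral>x. (norm (avg (subseq i) x - limit x))\<^sup>2 \<partial>circle_measure) \<longlonglongrightarrow> (\<integral>x. 0 \<partial>circle_measure)"
  proof (rule integral_dominated_convergence[where w = "\<lambda>_. (2 * bound)\<^sup>2"])
    show "AE x in circle_measure. (\<lambda>i. (norm (avg (subseq i) x - limit x))\<^sup>2) \<longlonglongrightarrow> 0"
      using AE_convergent
    proof eventually_elim
      case (elim x)
      have "(\<lambda>i. (norm (avg (subseq i) x - limit x))\<^sup>2) \<longlonglongrightarrow> (norm (limit x - limit x))\<^sup>2"
        by (intro tendsto_intros tendsto_limit elim)
      then show ?case by simp
    qed
    show "AE x in circle_measure. norm ((norm (avg (subseq i) x - limit x))\<^sup>2) \<le> (2 * bound)\<^sup>2" for i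
    proof (intro AE_I2)
      fix x
      have "norm (avg (subseq i) x - limit x) \<le> 2 * bound"
        using norm_triangle_le_diff[OF add_mono[OF norm_avg_le_bound norm_limit_le], of "subseq i" x x] by simp
      then show "norm ((norm (avg (subseq i) x - limit x))\<^sup>2) \<le> (2 * bound)\<^sup>2"
        unfolding real_norm_def abs_power2 by (intro power_mono norm_ge_zero)
    qed
  qed (auto intro!: measurable_circle_measure finite_measure.integrable_const finite_measure_circle_measure)
  then have sub: "(\<lambda>i. \<integral>x. (norm (avg (subseq i) x - limit x))\<^sup>2 \<partial>circle_measure) \<longlonglongrightarrow> 0" by simp
  show ?thesis
  proof (rule LIMSEQ_I)
    fix e :: real assume e: "e > 0"
    obtain N where N: "\<And>i j. i \<ge> N \<Longrightarrow> j \<ge> N \<Longrightarrow>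
        (\<integral>x. (norm (avg i x - avg j x))\<^sup>2 \<partial>circle_measure) < e / 4"
      using avg_L2_Cauchy[of "e / 4"] e by auto
    have "\<forall>\<^sub>F i in sequentially. (\<integral>x. (norm (avg (subseq i) x - limit x))\<^sup>2 \<partial>circle_measure) < e / 4"
      using e by (intro order_tendstoD(2)[OF sub]) simp
    from eventually_happens'[OF sequentially_bot eventually_conj[OF this eventually_ge_at_top[of N]]]
    obtain i where i: "i \<ge> N" "(\<integral>x. (norm (avg (subseq i) x - limit x))\<^sup>2 \<partial>circle_measure) < e / 4"
      by blast
    have "(\<integral>x. (norm (avg n x - limit x))\<^sup>2 \<partial>circle_measure) < e" if "n \<ge> N" for n
    proof -
      have i2: "subseq i \<ge> N"
        using i(1) strict_mono_imp_increasing[OF strict_mono_subseq, of i] by linarith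
      have int2: "integrable circle_measure (\<lambda>x. (norm (avg n x - avg (subseq i) x))\<^sup>2)"
        by (rule integrable_norm_diff_avg(2)) (simp_all add: norm_avg_le_bound)
      have "(\<integral>x. (norm (avg n x - limit x))\<^sup>2 \<partial>circle_measure) \<le>
        (\<integral>x. 2 * (norm (avg n x - avg (subseq i) x))\<^sup>2 + 2 * (norm (avg (subseq i) x - limit x))\<^sup>2 \<partial>circle_measure)"
      proof (rule integral_mono)
        show "integrable circle_measure (\<lambda>x. 2 * (norm (avg n x - avg (subseq i) x))\<^sup>2 +
            2 * (norm (avg (subseq i) x - limit x))\<^sup>2)"
          by (intro Bochner_Integration.integrable_add integrable_mult_right int int2)
        fix x
        show "(norm (avg n x - limit x))\<^sup>2 \<le>
          2 * (norm (avg n x - avg (subseq i) x))\<^sup>2 + 2 * (norm (avg (subseq i) x - limit x))\<^sup>2"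
          using norm_diff_power2_le_2[of "avg n x" "limit x" "avg (subseq i) x"]
          by (simp add: norm_minus_commute)
      qed (rule int)
      also have "\<dots> = 2 * (\<integral>x. (norm (avg n x - avg (subseq i) x))\<^sup>2 \<partial>circle_measure) +
          2 * (\<integral>x. (norm (avg (subseq i) x - limit x))\<^sup>2 \<partial>circle_measure)"
        using int int2 by simp
      also have "\<dots> < e"
        using N[OF that i2] i(2) by simp
      finally show ?thesis .
    qed
    then show "\<exists>N. \<forall>n\<ge>N. norm ((\<integral>x. (norm (avg n x - limit x))\<^sup>2 \<partial>circle_measure) - 0) < e"
      by (intro exI[of _ N]) auto
  qed
qed

lemma avg_L1_limit: "(\<lambda>n. \<integral>x. norm (avg n x - limit x) \<partial>circle_measure) \<longlonglongrightarrow> 0"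
proof (rule LIMSEQ_I)
  fix e :: real assume e: "e > 0"
  have "\<forall>\<^sub>F n in sequentially. (\<integral>x. (norm (avg n x - limit x))\<^sup>2 \<partial>circle_measure) < (e / 3)\<^sup>2"
    using e by (intro order_tendstoD(2)[OF avg_L2_limit]) simp
  then obtain N where N: "\<And>n. n \<ge> N \<Longrightarrow> (\<integral>x. (norm (avg n x - limit x))\<^sup>2 \<partial>circle_measure) < (e / 3)\<^sup>2"
    by (auto simp: eventually_sequentially)
  have "(\<integral>x. norm (avg n x - limit x) \<partial>circle_measure) \<le> 2 * (e / 3)" if "n \<ge> N" for n
    using N[OF that] e by (intro integral_norm_le_L2) (auto simp: norm_limit_le)
  then show "\<exists>N. \<forall>n\<ge>N. norm ((\<integral>x. norm (avg n x - limit x) \<partial>circle_measure) - 0) < e"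
    using e by (intro exI[of _ N]) fastforce
qed

end

section \<open>Ergodicity and the degree\<close>

lemma measurable_ident_circle [measurable]: "(\<lambda>x. x) \<in> borel_measurable circle_measure"
  by (rule measurable_circle_measure) simp

lemma measurable_fst_circle [measurable]: "fst \<in> borel_measurable (circle_measure \<Otimes>\<^sub>M circle_measure)"
  and measurable_snd_circle [measurable]: "snd \<in> borel_measurable (circle_measure \<Otimes>\<^sub>M circle_measure)"
  using measurable_compose[OF measurable_fst measurable_ident_circle]
    measurable_compose[OF measurable_snd measurable_ident_circle] by auto

lemma pair_sigma_finite_circle: "pair_sigma_finite circle_measure circle_measure"
  by (simp add: pair_sigma_finite_def finite_measure.axioms(1) finite_measure_circle_measure)

lemma AE_circle_exists:
  assumes "AE x in circle_measure. P x"
  shows "\<exists>x. P x"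
proof (rule ccontr)
  assume "\<nexists>x. P x"
  with assms have "AE x in circle_measure. False" by simp
  then have "emeasure circle_measure (space circle_measure) = 0"
    using AE_iff_measurable[OF sets.top, of circle_measure "\<lambda>_. False"]
    by (simp add: atLeastLessThan_def atLeast_def lessThan_def Collect_conj_eq)
  then show False by (simp add: emeasure_circle_measure)
qed

context SU2_cocycle
begin

text \<open>The modulus of continuity of \<open>limit\<close> under translation in
  \<open>L\<^sup>1\<close>.\<close>

definition modulus :: "real \<Rightarrow> real" where
  "modulus t = (\<integral>x. norm (limit (x + t) - limit x) \<partial>circle_measure)"

lemma integrable_modulus: "integrable circle_measure (\<lambda>x. norm (limit (x + t) - limit x))"
proof (rule integrable_circle_bounded[where B = "2 * bound"])
  fix x
  show "norm (norm (limit (x + t) - limit x)) \<le> 2 * bound"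
    using norm_triangle_le_diff[OF add_mono[OF norm_limit_le norm_limit_le], of "x + t" x] by simp
qed simp

text \<open>\<open>limit\<close> is close in mean to a continuous function \<open>avg n\<close>, for
  which small translations are harmless. Translation invariance makes the two approximation errors
  equal.\<close>

lemma modulus_small:
  assumes "\<epsilon> > 0"
  shows "\<exists>\<delta>>0. \<forall>t. \<bar>t\<bar> < \<delta> \<longrightarrow> modulus t < \<epsilon>"
proof -
  have "\<forall>\<^sub>F n in sequentially. (\<integral>x. norm (avg n x - limit x) \<partial>circle_measure) < \<epsilon> / 4"
    using assms by (intro order_tendstoD(2)[OF avg_L1_limit]) simp
  then obtain n where n: "(\<integral>x. norm (avg n x - limit x) \<partial>circle_measure) < \<epsilon> / 4"
    by (auto simp: eventually_sequentially)
  \<comment> \<open>This interval contains \<open>x\<close> and \<open>x + t\<close> for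
    \<open>x\<close> in the fundamental domain and \<open>\<bar>t\<bar> < 1\<close>.\<close>
  have "uniformly_continuous_on {-1..2} (avg n)"
    by (intro compact_uniformly_continuous continuous_on_subset[OF continuous_on_avg]) auto
  moreover have "\<epsilon> / 4 > 0" using assms by simp
  ultimately obtain \<delta> where \<delta>: "\<delta> > 0"
    "\<And>x y. x \<in> {-1..2} \<Longrightarrow> y \<in> {-1..2} \<Longrightarrow> dist y x < \<delta> \<Longrightarrow> dist (avg n y) (avg n x) < \<epsilon> / 4"
    unfolding uniformly_continuous_on_def by blast
  note int = integrable_norm_diff_avg(1)[OF limit_measurable norm_limit_le, of n]
  have int_t: "integrable circle_measure (\<lambda>x. norm (avg n (x + t) - limit (x + t)))" for t
  proof (rule integrable_circle_bounded[where B = "2 * bound"])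
    fix x
    show "norm (norm (avg n (x + t) - limit (x + t))) \<le> 2 * bound"
      using norm_triangle_le_diff[OF add_mono[OF norm_avg_le_bound norm_limit_le], of n "x + t" "x + t"] by simp
  qed simp
  have c: "integrable circle_measure (\<lambda>_. \<epsilon> / 4)"
    by (intro finite_measure.integrable_const finite_measure_circle_measure)
  have "modulus t < \<epsilon>" if t: "\<bar>t\<bar> < min \<delta> 1" for t
  proof -
    have "modulus t \<le> (\<integral>x. norm (avg n (x + t) - limit (x + t)) + \<epsilon> / 4 + norm (avg n x - limit x) \<partial>circle_measure)"
      unfolding modulus_def
    proof (rule integral_mono)
      fix x assume "x \<in> space circle_measure"
      then have "dist (avg n (x + t)) (avg n x) < \<epsilon> / 4"
        using t by (intro \<delta>(2)) (auto simp: dist_real_def)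
      moreover have "limit (x + t) - limit x = - (avg n (x + t) - limit (x + t)) +
          (avg n (x + t) - avg n x) + (avg n x - limit x)" by simp
      then have "norm (limit (x + t) - limit x) \<le> norm (- (avg n (x + t) - limit (x + t))) +
          norm (avg n (x + t) - avg n x) + norm (avg n x - limit x)"
        by (metis add_right_mono norm_triangle_ineq norm_triangle_le)
      ultimately show "norm (limit (x + t) - limit x) \<le>
          norm (avg n (x + t) - limit (x + t)) + \<epsilon> / 4 + norm (avg n x - limit x)"
        unfolding norm_minus_cancel dist_norm by linarith
    qed (intro integrable_modulus Bochner_Integration.integrable_add int int_t c)+
    also have "\<dots> = (\<integral>x. norm (avg n (x + t) - limit (x + t)) \<partial>circle_measure) + \<epsilon> / 4 +
        (\<integral>x. norm (avg n x - limit x) \<partial>circle_measure)"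
      using int int_t c by simp
    also have "(\<integral>x. norm (avg n (x + t) - limit (x + t)) \<partial>circle_measure) =
        (\<integral>x. norm (avg n x - limit x) \<partial>circle_measure)"
      by (rule integral_circle_shift) (simp_all add: avg_periodic limit_periodic)
    finally show ?thesis using n assms by linarith
  qed
  then show ?thesis
    using \<delta>(1) by (intro exI[of _ "min \<delta> 1"]) auto
qed

lemma limit_shift: "norm (limit (x + real n * \<alpha>)) = norm (limit x)"
  using norm_twist[of n limit x] by (simp add: twist_limit)

text \<open>The hypothesis holds for every irrational \<open>\<alpha>\<close>; for the golden ratio, \<open>\<tau>\<close> is a power of it.\<close>

lemma AE_norm_limit_const:
  assumes "\<And>\<eta>. \<eta> > 0 \<Longrightarrow> \<exists>\<tau>. 0 < \<bar>\<tau>\<bar> \<and> \<bar>\<tau>\<bar> < \<eta> \<and> (\<forall>x. norm (limit (x + \<tau>)) = norm (limit x))"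
  shows "\<exists>c. AE x in circle_measure. norm (limit x) = c"
proof -
  define N where "N x = norm (limit x)" for x
  have [measurable]: "N \<in> borel_measurable borel" unfolding N_def[abs_def] by measurable
  have Nper: "N (x + 1) = N x" for x by (simp add: N_def limit_periodic)
  have le: "\<bar>N (x + t) - N x\<bar> \<le> norm (limit (x + t) - limit x)" for x t
    unfolding N_def by (rule norm_triangle_ineq3)
  have int: "integrable circle_measure (\<lambda>x. \<bar>N (x + t) - N x\<bar>)" for t
    by (rule Bochner_Integration.integrable_bound[OF integrable_modulus[of t]])
      (use le in \<open>auto intro!: measurable_circle_measure\<close>)
  \<comment> \<open>\<open>t\<close> is replaced by its remainder \<open>s\<close> modulo an
    arbitrarily small period \<open>\<tau>\<close> of \<open>N\<close>; continuity of translation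
    then makes the integral smaller than any \<open>e\<close>.\<close>
  have zero: "(\<integral>\<^sup>+x. ennreal \<bar>N (x + t) - N x\<bar> \<partial>circle_measure) = 0" for t
  proof -
    have "(\<integral>x. \<bar>N (x + t) - N x\<bar> \<partial>circle_measure) \<le> 0"
    proof (rule field_le_epsilon)
      fix e :: real assume "e > 0"
      then obtain \<delta> where \<delta>: "\<delta> > 0" "\<And>s. \<bar>s\<bar> < \<delta> \<Longrightarrow> modulus s < e"
        using modulus_small by blast
      obtain \<tau> where \<tau>: "0 < \<bar>\<tau>\<bar>" "\<bar>\<tau>\<bar> < \<delta>" "\<And>x. N (x + \<tau>) = N x"
        using assms[OF \<delta>(1)] unfolding N_def by blast
      define k where "k = \<lfloor>t / \<tau>\<rfloor>"
      define s where "s = t - of_int k * \<tau>"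
      have "s = \<tau> * frac (t / \<tau>)"
        using \<tau>(1) by (simp add: s_def k_def frac_def algebra_simps)
      then have "\<bar>s\<bar> \<le> \<bar>\<tau>\<bar>"
        using frac_lt_1[of "t / \<tau>"] by (simp add: abs_mult frac_ge_0 mult_left_le less_imp_le)
      have "N (x + t) = N (x + s)" for x
      proof -
        \<comment> \<open>The rescaled function \<open>\<lambda>u. N (u * \<tau>)\<close> has period
          1, so \<open>periodic_int\<close> applies to it.\<close>
        have "N (((x + s) / \<tau> + of_int k) * \<tau>) = N ((x + s) / \<tau> * \<tau>)"
          by (rule periodic_int) (simp add: distrib_right \<tau>(3))
        moreover have "((x + s) / \<tau> + of_int k) * \<tau> = x + t" "(x + s) / \<tau> * \<tau> = x + s"
          using \<tau>(1) by (simp_all add: s_def field_simps)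
        ultimately show ?thesis by simp
      qed
      then have "(\<integral>x. \<bar>N (x + t) - N x\<bar> \<partial>circle_measure) = (\<integral>x. \<bar>N (x + s) - N x\<bar> \<partial>circle_measure)"
        by simp
      also have "\<dots> \<le> modulus s"
        unfolding modulus_def by (intro integral_mono int integrable_modulus le)
      also have "\<dots> \<le> 0 + e"
        using \<delta>(2)[of s] \<open>\<bar>s\<bar> \<le> \<bar>\<tau>\<bar>\<close> \<tau>(2) by simp
      finally show "(\<integral>x. \<bar>N (x + t) - N x\<bar> \<partial>circle_measure) \<le> 0 + e" .
    qed
    then show ?thesis
      using nn_integral_eq_integral[OF int, of t] by (simp add: ennreal_neg)
  qed
  interpret pair_sigma_finite circle_measure circle_measure
    by (rule pair_sigma_finite_circle)
  \<comment> \<open>Exchanging the integrals yields a single base point \<open>x\<close> with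
    \<open>N (x + t) = N x\<close> for almost every \<open>t\<close>; \<open>N x\<close> is then the
    constant.\<close>
  have "(\<integral>\<^sup>+x. \<integral>\<^sup>+t. ennreal \<bar>N (x + t) - N x\<bar> \<partial>circle_measure \<partial>circle_measure) =
      (\<integral>\<^sup>+t. \<integral>\<^sup>+x. ennreal \<bar>N (x + t) - N x\<bar> \<partial>circle_measure \<partial>circle_measure)"
    by (rule Fubini'[symmetric]) (simp add: split_def)
  then have "(\<integral>\<^sup>+x. \<integral>\<^sup>+t. ennreal \<bar>N (x + t) - N x\<bar> \<partial>circle_measure \<partial>circle_measure) = 0"
    by (simp add: zero)
  moreover have "(\<lambda>x. \<integral>\<^sup>+t. ennreal \<bar>N (x + t) - N x\<bar> \<partial>circle_measure) \<in> borel_measurable circle_measure"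
    by (rule sigma_finite_measure.borel_measurable_nn_integral[OF finite_measure.axioms(1)[OF finite_measure_circle_measure]]) (simp add: split_def)
  ultimately have "AE x in circle_measure. (\<integral>\<^sup>+t. ennreal \<bar>N (x + t) - N x\<bar> \<partial>circle_measure) = 0"
    by (simp add: nn_integral_0_iff_AE)
  then obtain x where "(\<integral>\<^sup>+t. ennreal \<bar>N (x + t) - N x\<bar> \<partial>circle_measure) = 0"
    using AE_circle_exists by blast
  then have "(\<integral>\<^sup>+t. ennreal \<bar>N t - N x\<bar> \<partial>circle_measure) = 0"
    using nn_integral_circle_shift[of "\<lambda>t. ennreal \<bar>N t - N x\<bar>" x] by (simp add: Nper add.commute)
  then have "AE t in circle_measure. N t = N x"
    by (subst (asm) nn_integral_0_iff_AE) (auto intro!: measurable_circle_measure)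
  then show ?thesis unfolding N_def by blast
qed

section \<open>Identification of the degree\<close>

lemma su2_norm_avg_diff:
  assumes "\<psi> x \<in> su2"
  shows "(su2_norm ((1 / real n) *\<^sub>R log_deriv (iter n) x - \<psi> x))\<^sup>2 = (norm (avg n x - \<psi> x))\<^sup>2 / 2"
proof -
  have "(1 / real n) *\<^sub>R log_deriv (iter n) x = avg n x"
    by (simp add: log_deriv_iter mean_def)
  then show ?thesis
    by (simp add: su2_norm_eq su2_diff avg_su2 assms power_divide)
qed

lemma log_deriv_limit_limit: "log_deriv_limit \<alpha> \<phi> limit"
proof -
  have "integrable circle_measure (\<lambda>x. (norm (limit x))\<^sup>2 / 2)"
    by (rule integrable_divide, rule integrable_circle_bounded[where B = "bound\<^sup>2"])
      (auto intro!: power_mono norm_limit_le)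
  then have "in_L2_su2 limit"
    by (auto simp: in_L2_su2_def limit_su2 su2_norm_eq power_divide intro!: measurable_circle_measure)
  moreover have "(\<lambda>n. (\<integral>x. (norm (avg n x - limit x))\<^sup>2 \<partial>circle_measure) / 2) \<longlonglongrightarrow> 0 / 2"
    by (intro tendsto_divide avg_L2_limit tendsto_const) simp
  ultimately show ?thesis
    by (simp add: log_deriv_limit_def su2_norm_avg_diff limit_su2)
qed

text \<open>Uniqueness of \<open>L\<^sup>2\<close> limits up to null sets. Since
  \<open>\<psi>\<close> may be unbounded, integrability in \<open>sqd\<close> comes from its square
  integrability; the factor 4 in \<open>le\<close> absorbs the 1/2 relating the two norms.\<close>

lemma log_deriv_limit_unique:
  assumes "log_deriv_limit \<alpha> \<phi> \<psi>"
  shows "AE x in circle_measure. \<psi> x = limit x"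
proof -
  have [measurable]: "\<psi> \<in> borel_measurable circle_measure" and su2: "\<And>x. \<psi> x \<in> su2"
    and sq: "integrable circle_measure (\<lambda>x. (su2_norm (\<psi> x))\<^sup>2)"
    and lim: "(\<lambda>n. (\<integral>x. (norm (avg n x - \<psi> x))\<^sup>2 / 2 \<partial>circle_measure)) \<longlonglongrightarrow> 0"
    using assms unfolding log_deriv_limit_def in_L2_su2_def by (auto simp: su2_norm_avg_diff)
  have [measurable]: "limit \<in> borel_measurable circle_measure" "avg n \<in> borel_measurable circle_measure" for n
    by (simp_all add: measurable_circle_measure)
  have sq': "integrable circle_measure (\<lambda>x. (norm (\<psi> x))\<^sup>2)"
    using integrable_mult_right[of 2, OF sq] by (simp add: su2_norm_eq su2 power_divide)
  have b: "integrable circle_measure (\<lambda>x. 2 * bound\<^sup>2 + 2 * (norm (\<psi> x))\<^sup>2)"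
    by (intro Bochner_Integration.integrable_add integrable_mult_right sq'
        finite_measure.integrable_const finite_measure_circle_measure)
  have sqd: "integrable circle_measure (\<lambda>x. (norm (g x - \<psi> x))\<^sup>2)"
    if [measurable]: "g \<in> borel_measurable circle_measure" and g: "\<And>x. norm (g x) \<le> bound" for g
  proof (rule Bochner_Integration.integrable_bound[OF b], measurable, intro AE_I2)
    fix x
    have "(norm (g x))\<^sup>2 \<le> bound\<^sup>2" by (intro power_mono g norm_ge_zero)
    then show "norm ((norm (g x - \<psi> x))\<^sup>2) \<le> norm (2 * bound\<^sup>2 + 2 * (norm (\<psi> x))\<^sup>2)"
      using norm_diff_power2_le_2[of "g x" "\<psi> x" 0] by simp
  qed
  note i1 = sqd[of "avg _", OF _ norm_avg_le_bound, simplified]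
    and i2 = sqd[of limit, OF _ norm_limit_le, simplified]
    and i3 = integrable_norm_diff_avg(2)[OF limit_measurable norm_limit_le]
  have le: "(\<integral>x. (norm (limit x - \<psi> x))\<^sup>2 \<partial>circle_measure) \<le>
      2 * (\<integral>x. (norm (avg n x - limit x))\<^sup>2 \<partial>circle_measure) +
      4 * (\<integral>x. (norm (avg n x - \<psi> x))\<^sup>2 / 2 \<partial>circle_measure)" for n
  proof -
    have "(\<integral>x. (norm (limit x - \<psi> x))\<^sup>2 \<partial>circle_measure) \<le>
       (\<integral>x. 2 * (norm (avg n x - limit x))\<^sup>2 + 2 * (norm (avg n x - \<psi> x))\<^sup>2 \<partial>circle_measure)"
      by (intro integral_mono i1 i2 i3 Bochner_Integration.integrable_add integrable_mult_right
          norm_diff_power2_le_2)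
    also have "\<dots> = 2 * (\<integral>x. (norm (avg n x - limit x))\<^sup>2 \<partial>circle_measure) +
      4 * (\<integral>x. (norm (avg n x - \<psi> x))\<^sup>2 / 2 \<partial>circle_measure)"
      using i1[of n] i3[of n] by simp
    finally show ?thesis .
  qed
  have "(\<integral>x. (norm (limit x - \<psi> x))\<^sup>2 \<partial>circle_measure) \<le> 2 * 0 + 4 * 0"
    by (rule LIMSEQ_le_const[OF tendsto_add[OF tendsto_mult_left[OF avg_L2_limit] tendsto_mult_left[OF lim]]])
      (use le in blast)
  moreover have "(\<integral>x. (norm (limit x - \<psi> x))\<^sup>2 \<partial>circle_measure) \<ge> 0" by simp
  ultimately have "(\<integral>x. (norm (limit x - \<psi> x))\<^sup>2 \<partial>circle_measure) = 0" by linarith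
  then have "AE x in circle_measure. (norm (limit x - \<psi> x))\<^sup>2 = 0"
    using integral_nonneg_eq_0_iff_AE[OF i2] by simp
  then show ?thesis by eventually_elim simp
qed

text \<open>\<open>limit\<close> itself witnesses the value \<open>d\<close>, and any other
  admissible function agrees with it almost everywhere, so the description in
  \<open>cocycle_degree\<close> is unique.\<close>

lemma cocycle_degree_eq:
  assumes "AE x in circle_measure. norm (limit x) = sqrt 2 * d"
  shows "cocycle_degree \<alpha> \<phi> = d"
  unfolding cocycle_degree_def
proof (rule the_equality)
  have d: "AE x in circle_measure. su2_norm (limit x) = d"
    using assms by eventually_elim (simp add: su2_norm_eq limit_su2)
  with log_deriv_limit_limit
  show "\<exists>\<psi>. log_deriv_limit \<alpha> \<phi> \<psi> \<and> (AE x in circle_measure. su2_norm (\<psi> x) = d)" by blast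
  fix d' assume "\<exists>\<psi>. log_deriv_limit \<alpha> \<phi> \<psi> \<and> (AE x in circle_measure. su2_norm (\<psi> x) = d')"
  then obtain \<psi> where \<psi>: "log_deriv_limit \<alpha> \<phi> \<psi>" "AE x in circle_measure. su2_norm (\<psi> x) = d'" by blast
  from log_deriv_limit_unique[OF \<psi>(1)] \<psi>(2) d have "AE x in circle_measure. d' = d"
    by eventually_elim simp
  then show "d' = d" using AE_circle_exists[of "\<lambda>_. d' = d"] by simp
qed

end

section \<open>Quantization\<close>

text \<open>Connects the Lebesgue integral over the half-open circle with the gauge integral of the
  fundamental theorem of calculus; the endpoint is negligible.\<close>

lemma integral_circle_measure_eq:
  fixes f :: "real \<Rightarrow> real"
  assumes "continuous_on UNIV f"
  shows "(\<integral>x. f x \<partial>circle_measure) = integral {0..1} f"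
proof -
  have "set_integrable lborel {0..1} f"
    by (intro borel_integrable_atLeastAtMost' continuous_on_subset[OF assms]) auto
  then have si: "set_integrable lborel {0..<1} f"
    by (rule set_integrable_subset) auto
  have "(\<integral>x. f x \<partial>circle_measure) = (LINT x:{0..<1}|lborel. f x)"
    by (simp add: circle_measure_def integral_restrict_space set_lebesgue_integral_def)
  also have "\<dots> = integral {0..<1} f"
    by (rule set_borel_integral_eq_integral(2)[OF si])
  also have "\<dots> = integral {0..1} f"
  proof (rule integral_spike_set)
    have "negligible {1::real}" by simp
    then show "negligible {x \<in> {0..<1} - {0..1}. f x \<noteq> 0}" "negligible {x \<in> {0..1} - {0..<1}. f x \<noteq> 0}"
      by (rule negligible_subset, force)+
  qed
  finally show ?thesis .
qed

context SU2_cocycle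
begin

lemma iter_has_vector_derivative_avg:
  assumes "0 < n"
  shows "(iter n has_vector_derivative real n *\<^sub>R (avg n x ** iter n x)) (at x)"
  using iter_has_vector_derivative[of n x] assms
  by (simp add: mean_def matrix_mult.scaleR_left)

text \<open>Since all factors are unitary, the derivative of \<open>s \<mapsto> su2_exp d H (- s c) ** iter n (x + s \<delta>)\<close>,
  \<open>c = n \<delta>\<close>, has norm \<open>\<bar>c\<bar> \<parallel>avg n (x + s \<delta>) - H\<parallel>\<close>.\<close>

lemma iter_shift_approx:
  assumes n: "0 < n" and H: "H \<in> su2" "norm H = sqrt 2 * d" "d > 0"
  shows "norm (iter n (x + \<delta>) - su2_exp d H (real n * \<delta>) ** iter n x) \<le>
    \<bar>real n * \<delta>\<bar> * (\<integral>s. norm (avg n (x + s * \<delta>) - H) \<partial>circle_measure)"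
proof -
  define c where "c = real n * \<delta>"
  define E where "E s = su2_exp d H (- s * c)" for s
  \<comment> \<open>\<open>y\<close> compares the iterate with the flow generated by the constant
    matrix \<open>H\<close>: it would be constant if \<open>avg n\<close> were equal to
    \<open>H\<close> along the segment.\<close>
  define y where "y s = E s ** iter n (x + s * \<delta>)" for s
  define y' where "y' s = E s ** (c *\<^sub>R (avg n (x + s * \<delta>) - H)) ** iter n (x + s * \<delta>)" for s
  have E_SU2: "E s \<in> SU2" for s
    unfolding E_def by (intro su2_exp_SU2 H)
  have dE: "(E has_vector_derivative - c *\<^sub>R (H ** E s)) (at s)" for s
  proof -
    have "((\<lambda>s. - s * c) has_vector_derivative - c) (at s)"
      by (auto intro!: derivative_eq_intros)
    from vector_diff_chain_at[OF this su2_exp_has_vector_derivative[OF H]] show ?thesis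
      by (simp add: o_def E_def[abs_def])
  qed
  have dI: "((\<lambda>s. iter n (x + s * \<delta>)) has_vector_derivative
      c *\<^sub>R (avg n (x + s * \<delta>) ** iter n (x + s * \<delta>))) (at s)" for s
  proof -
    have "((\<lambda>s. x + s * \<delta>) has_vector_derivative \<delta>) (at s)"
      by (auto intro!: derivative_eq_intros)
    from vector_diff_chain_at[OF this iter_has_vector_derivative_avg[OF n]] show ?thesis
      by (simp add: o_def c_def mult.commute)
  qed
  have EH: "E s ** H = H ** E s" for s
    unfolding E_def by (rule su2_exp_commute)
  have dy: "(y has_vector_derivative y' s) (at s within {0..1})" for s
  proof -
    have "(y has_vector_derivative E s ** (c *\<^sub>R (avg n (x + s * \<delta>) ** iter n (x + s * \<delta>))) +
        (- c *\<^sub>R (H ** E s)) ** iter n (x + s * \<delta>)) (at s)"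
      unfolding y_def[abs_def] by (rule matrix_mult.has_vector_derivative[OF dE dI])
    moreover have "E s ** (c *\<^sub>R (avg n (x + s * \<delta>) ** iter n (x + s * \<delta>))) +
        (- c *\<^sub>R (H ** E s)) ** iter n (x + s * \<delta>) = y' s"
      by (simp add: y'_def matrix_mult.scaleR_left matrix_mult.scaleR_right matrix_mult.diff_left matrix_mult.diff_right matrix_mult.minus_left
          scaleR_diff_right matrix_mul_assoc flip: EH)
    ultimately show ?thesis
      using has_vector_derivative_at_within by metis
  qed
  have norm_y': "norm (y' s) = \<bar>c\<bar> * norm (avg n (x + s * \<delta>) - H)" for s
    by (simp add: y'_def norm_SU2_mult_left norm_SU2_mult_right E_SU2 iter_SU2)
  have cont: "continuous_on UNIV (\<lambda>s. norm (avg n (x + s * \<delta>) - H))"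
    by (intro continuous_intros continuous_on_compose2[OF continuous_on_avg]) auto
  have "(y' has_integral (y 1 - y 0)) {0..1}"
    by (rule fundamental_theorem_of_calculus) (simp_all add: dy)
  then have int_y': "y' integrable_on {0..1}" and eq: "y 1 - y 0 = integral {0..1} y'"
    by (auto simp: integral_unique)
  have "(\<lambda>s. \<bar>c\<bar> * norm (avg n (x + s * \<delta>) - H)) integrable_on {0..1}"
    by (intro integrable_continuous_interval continuous_on_mult_left continuous_on_subset[OF cont]) auto
  then have "norm (y 1 - y 0) \<le> integral {0..1} (\<lambda>s. \<bar>c\<bar> * norm (avg n (x + s * \<delta>) - H))"
    unfolding eq by (intro integral_norm_bound_integral int_y') (simp_all add: norm_y')
  also have "\<dots> = \<bar>c\<bar> * (\<integral>s. norm (avg n (x + s * \<delta>) - H) \<partial>circle_measure)"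
    by (simp add: integral_circle_measure_eq[OF cont])
  finally have *: "norm (y 1 - y 0) \<le> \<bar>c\<bar> * (\<integral>s. norm (avg n (x + s * \<delta>) - H) \<partial>circle_measure)" .
  have ct: "conj_transpose (E 1) = su2_exp d H c"
    unfolding E_def by (simp add: conj_transpose_su2_exp H)
  \<comment> \<open>Undoing the unitary factor \<open>E 1\<close> turns the increment of
    \<open>y\<close> into the required difference without changing its norm.\<close>
  have "norm (y 1 - y 0) = norm (conj_transpose (E 1) ** (y 1 - y 0))"
    by (simp add: norm_SU2_mult_left conj_transpose_SU2 E_SU2)
  also have "conj_transpose (E 1) ** (y 1 - y 0) = iter n (x + \<delta>) - su2_exp d H c ** iter n x"
  proof -
    have "conj_transpose (E 1) ** y 1 = iter n (x + \<delta>)"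
      by (simp add: y_def matrix_mul_assoc SU2_mult_conj_transpose E_SU2)
    moreover have "y 0 = iter n x" by (simp add: y_def E_def)
    ultimately show ?thesis by (simp add: matrix_mult.diff_right ct)
  qed
  finally show ?thesis using * by (simp add: c_def)
qed

text \<open>After exchanging the integrals, each shift \<open>s * \<delta>\<close> is treated
  separately: the distance splits into the error of \<open>avg n\<close> at the shifted point, whose
  integral does not depend on the shift, and the modulus of continuity of
  \<open>limit\<close>.\<close>

lemma nn_integral_window_small:
  assumes "\<epsilon> > 0"
  shows "\<exists>\<eta>>0. \<exists>N. \<forall>n\<ge>N. \<forall>\<delta>. \<bar>\<delta>\<bar> < \<eta> \<longrightarrow>
    (\<integral>\<^sup>+x. \<integral>\<^sup>+s. ennreal (norm (avg n (x + s * \<delta>) - limit x)) \<partial>circle_measure \<partial>circle_measure) \<le> ennreal \<epsilon>"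
proof -
  obtain \<eta> where \<eta>: "\<eta> > 0" "\<And>t. \<bar>t\<bar> < \<eta> \<Longrightarrow> modulus t < \<epsilon> / 2"
    using modulus_small[of "\<epsilon> / 2"] assms by auto
  have "\<forall>\<^sub>F n in sequentially. (\<integral>x. norm (avg n x - limit x) \<partial>circle_measure) < \<epsilon> / 2"
    using assms by (intro order_tendstoD(2)[OF avg_L1_limit]) simp
  then obtain N where N: "\<And>n. n \<ge> N \<Longrightarrow> (\<integral>x. norm (avg n x - limit x) \<partial>circle_measure) < \<epsilon> / 2"
    by (auto simp: eventually_sequentially)
  interpret pair_sigma_finite circle_measure circle_measure
    by (rule pair_sigma_finite_circle)
  have "(\<integral>\<^sup>+x. \<integral>\<^sup>+s. ennreal (norm (avg n (x + s * \<delta>) - limit x)) \<partial>circle_measure \<partial>circle_measure) \<le> ennreal \<epsilon>"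
    if n: "n \<ge> N" and \<delta>: "\<bar>\<delta>\<bar> < \<eta>" for n \<delta>
  proof -
    have inner: "(\<integral>\<^sup>+x. ennreal (norm (avg n (x + t) - limit x)) \<partial>circle_measure) \<le> ennreal \<epsilon>"
      if t: "\<bar>t\<bar> < \<eta>" for t
    proof -
      have "(\<integral>\<^sup>+x. ennreal (norm (avg n (x + t) - limit x)) \<partial>circle_measure) \<le>
          (\<integral>\<^sup>+x. ennreal (norm (avg n (x + t) - limit (x + t))) + ennreal (norm (limit (x + t) - limit x)) \<partial>circle_measure)"
      proof (rule nn_integral_mono)
        fix x
        have "norm (avg n (x + t) - limit x) \<le> norm (avg n (x + t) - limit (x + t)) + norm (limit (x + t) - limit x)"
          using norm_triangle_ineq[of "avg n (x + t) - limit (x + t)" "limit (x + t) - limit x"] by simp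
        then show "ennreal (norm (avg n (x + t) - limit x)) \<le>
            ennreal (norm (avg n (x + t) - limit (x + t))) + ennreal (norm (limit (x + t) - limit x))"
          by (simp flip: ennreal_plus)
      qed
      also have "\<dots> = (\<integral>\<^sup>+x. ennreal (norm (avg n (x + t) - limit (x + t))) \<partial>circle_measure) +
          (\<integral>\<^sup>+x. ennreal (norm (limit (x + t) - limit x)) \<partial>circle_measure)"
        by (intro nn_integral_add measurable_circle_measure) measurable
      also have "(\<integral>\<^sup>+x. ennreal (norm (avg n (x + t) - limit (x + t))) \<partial>circle_measure) =
          (\<integral>\<^sup>+x. ennreal (norm (avg n x - limit x)) \<partial>circle_measure)"
        by (rule nn_integral_circle_shift) (simp_all add: avg_periodic limit_periodic)
      also have "\<dots> = ennreal (\<integral>x. norm (avg n x - limit x) \<partial>circle_measure)"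
        by (intro nn_integral_eq_integral integrable_norm_diff_avg(1)) (simp_all add: norm_limit_le)
      also have "(\<integral>\<^sup>+x. ennreal (norm (limit (x + t) - limit x)) \<partial>circle_measure) = ennreal (modulus t)"
        unfolding modulus_def by (intro nn_integral_eq_integral integrable_modulus) simp
      also have "ennreal (\<integral>x. norm (avg n x - limit x) \<partial>circle_measure) + ennreal (modulus t) \<le> ennreal \<epsilon>"
      proof -
        have "0 \<le> modulus t" by (simp add: modulus_def)
        then show ?thesis
          using N[OF n] \<eta>(2)[OF t] by (simp add: ennreal_leI del: ennreal_plus flip: ennreal_plus)
      qed
      finally show ?thesis .
    qed
    have "(\<integral>\<^sup>+x. \<integral>\<^sup>+s. ennreal (norm (avg n (x + s * \<delta>) - limit x)) \<partial>circle_measure \<partial>circle_measure) =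
        (\<integral>\<^sup>+s. \<integral>\<^sup>+x. ennreal (norm (avg n (x + s * \<delta>) - limit x)) \<partial>circle_measure \<partial>circle_measure)"
      by (rule Fubini'[symmetric]) (simp add: split_def)
    also have "\<dots> \<le> (\<integral>\<^sup>+s. ennreal \<epsilon> \<partial>circle_measure)"
    proof (rule nn_integral_mono)
      fix s assume "s \<in> space circle_measure"
      then have "\<bar>s * \<delta>\<bar> \<le> 1 * \<bar>\<delta>\<bar>"
        unfolding abs_mult by (intro mult_right_mono) auto
      then show "(\<integral>\<^sup>+x. ennreal (norm (avg n (x + s * \<delta>) - limit x)) \<partial>circle_measure) \<le> ennreal \<epsilon>"
        using \<delta> by (intro inner) simp
    qed
    also have "\<dots> = ennreal \<epsilon>"
      by (simp add: emeasure_circle_measure)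
    finally show ?thesis .
  qed
  with \<eta>(1) show ?thesis by blast
qed

text \<open>The window conditions are imposed on two return times at once; they hold off a set of small
  measure, hence at a point where \<open>\<parallel>limit x\<parallel>\<close> has its almost sure value.\<close>

lemma exists_good_point:
  assumes c: "AE x in circle_measure. norm (limit x) = c" and "\<epsilon> > 0"
  shows "\<exists>\<eta>>0. \<exists>N. \<forall>n\<ge>N. \<forall>n'\<ge>N. \<forall>\<delta> \<delta>'. \<bar>\<delta>\<bar> < \<eta> \<longrightarrow> \<bar>\<delta>'\<bar> < \<eta> \<longrightarrow>
    (\<exists>x. norm (limit x) = c \<and>
      (\<integral>s. norm (avg n' (x + s * \<delta>) - limit x) \<partial>circle_measure) < \<epsilon> \<and>
      (\<integral>s. norm (avg n (x + s * \<delta>') - limit x) \<partial>circle_measure) < \<epsilon> \<and>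
      norm (limit (x + \<delta>) - limit x) < \<epsilon> \<and> norm (limit (x + \<delta>') - limit x) < \<epsilon>)"
proof -
  \<comment> \<open>Four nonnegative quantities with integral at most \<open>e\<close> add up to at
    most \<open>\<epsilon> / 2\<close>, so their sum \<open>F\<close> cannot be at least
    \<open>\<epsilon>\<close> almost everywhere.\<close>
  define e where "e = \<epsilon> / 8"
  have e: "e > 0" using assms(2) by (simp add: e_def)
  obtain \<eta>1 N where \<eta>1: "\<eta>1 > 0" and W: "\<And>n \<delta>. n \<ge> N \<Longrightarrow> \<bar>\<delta>\<bar> < \<eta>1 \<Longrightarrow>
    (\<integral>\<^sup>+x. \<integral>\<^sup>+s. ennreal (norm (avg n (x + s * \<delta>) - limit x)) \<partial>circle_measure \<partial>circle_measure) \<le> ennreal e"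
    using nn_integral_window_small[OF e] by blast
  obtain \<eta>2 where \<eta>2: "\<eta>2 > 0" "\<And>t. \<bar>t\<bar> < \<eta>2 \<Longrightarrow> modulus t < e"
    using modulus_small[OF e] by blast
  have "\<exists>x. norm (limit x) = c \<and>
      (\<integral>s. norm (avg n' (x + s * \<delta>) - limit x) \<partial>circle_measure) < \<epsilon> \<and>
      (\<integral>s. norm (avg n (x + s * \<delta>') - limit x) \<partial>circle_measure) < \<epsilon> \<and>
      norm (limit (x + \<delta>) - limit x) < \<epsilon> \<and> norm (limit (x + \<delta>') - limit x) < \<epsilon>"
    if n: "n \<ge> N" "n' \<ge> N" and \<delta>: "\<bar>\<delta>\<bar> < min \<eta>1 \<eta>2" "\<bar>\<delta>'\<bar> < min \<eta>1 \<eta>2" for n n' \<delta> \<delta>'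
  proof -
    define w where "w n \<delta> x = (\<integral>\<^sup>+s. ennreal (norm (avg n (x + s * \<delta>) - limit x)) \<partial>circle_measure)" for n \<delta> x
    define v where "v \<delta> x = ennreal (norm (limit (x + \<delta>) - limit x))" for \<delta> x
    define F where "F x = w n' \<delta> x + w n \<delta>' x + (v \<delta> x + v \<delta>' x)" for x
    have [measurable]: "w k t \<in> borel_measurable circle_measure" for k t
      unfolding w_def
      by (rule sigma_finite_measure.borel_measurable_nn_integral[OF finite_measure.axioms(1)[OF finite_measure_circle_measure]])
        (simp add: split_def)
    have [measurable]: "v t \<in> borel_measurable circle_measure" for t
      unfolding v_def by (intro measurable_circle_measure) measurable
    have v_int: "(\<integral>\<^sup>+x. v t x \<partial>circle_measure) \<le> ennreal e" if "\<bar>t\<bar> < \<eta>2" for t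
    proof -
      have "(\<integral>\<^sup>+x. v t x \<partial>circle_measure) = ennreal (modulus t)"
        unfolding v_def modulus_def by (intro nn_integral_eq_integral integrable_modulus) simp
      then show ?thesis using \<eta>2(2)[OF that] by (simp add: ennreal_leI)
    qed
    have w_int: "(\<integral>\<^sup>+x. w k t x \<partial>circle_measure) \<le> ennreal e" if "k \<ge> N" "\<bar>t\<bar> < \<eta>1" for k t
      unfolding w_def by (rule W[OF that])
    have "(\<integral>\<^sup>+x. F x \<partial>circle_measure) = (\<integral>\<^sup>+x. w n' \<delta> x \<partial>circle_measure) + (\<integral>\<^sup>+x. w n \<delta>' x \<partial>circle_measure) +
        ((\<integral>\<^sup>+x. v \<delta> x \<partial>circle_measure) + (\<integral>\<^sup>+x. v \<delta>' x \<partial>circle_measure))"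
      unfolding F_def by (simp add: nn_integral_add)
    also have "\<dots> \<le> ennreal e + ennreal e + (ennreal e + ennreal e)"
      using n \<delta> by (intro add_mono w_int v_int) auto
    also have "\<dots> = ennreal (\<epsilon> / 2)"
      using e by (simp add: e_def flip: ennreal_plus)
    finally have F_int: "(\<integral>\<^sup>+x. F x \<partial>circle_measure) \<le> ennreal (\<epsilon> / 2)" .
    have "\<exists>x. norm (limit x) = c \<and> F x < ennreal \<epsilon>"
    proof (rule ccontr)
      assume "\<nexists>x. norm (limit x) = c \<and> F x < ennreal \<epsilon>"
      then have "AE x in circle_measure. ennreal \<epsilon> \<le> F x"
        using c by (auto elim!: eventually_mono simp: not_less)
      then have "(\<integral>\<^sup>+x. ennreal \<epsilon> \<partial>circle_measure) \<le> (\<integral>\<^sup>+x. F x \<partial>circle_measure)"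
        by (rule nn_integral_mono_AE)
      then have "ennreal \<epsilon> \<le> ennreal (\<epsilon> / 2)"
        using F_int by (simp add: emeasure_circle_measure)
      then show False using \<open>\<epsilon> > 0\<close> by simp
    qed
    then obtain x where x: "norm (limit x) = c" "F x < ennreal \<epsilon>" by blast
    have "w n' \<delta> x \<le> F x" "w n \<delta>' x \<le> F x" "v \<delta> x \<le> F x" "v \<delta>' x \<le> F x"
      unfolding F_def by (simp_all add: add_increasing add_increasing2)
    with x(2) have lt: "w n' \<delta> x < ennreal \<epsilon>" "w n \<delta>' x < ennreal \<epsilon>" "v \<delta> x < ennreal \<epsilon>" "v \<delta>' x < ennreal \<epsilon>"
      by (auto intro: le_less_trans)
    have w_eq: "w k t x = ennreal (\<integral>s. norm (avg k (x + s * t) - limit x) \<partial>circle_measure)" for k t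
      unfolding w_def
    proof (rule nn_integral_eq_integral)
      show "integrable circle_measure (\<lambda>s. norm (avg k (x + s * t) - limit x))"
      proof (rule integrable_circle_bounded[where B = "2 * bound"])
        fix s
        show "norm (norm (avg k (x + s * t) - limit x)) \<le> 2 * bound"
          using norm_triangle_le_diff[OF add_mono[OF norm_avg_le_bound norm_limit_le], of k "x + s * t" x] by simp
      qed simp
    qed simp
    show ?thesis
      using x(1) lt unfolding w_eq v_def by (intro exI[of _ x]) (simp add: ennreal_less_iff)
  qed
  then show ?thesis
    using \<eta>1 \<eta>2(1) by (intro exI[of _ "min \<eta>1 \<eta>2"] conjI exI[of _ N]) auto
qed

end

section \<open>Fibonacci return times\<close>

text \<open>Both sides satisfy the Fibonacci recurrence, because \<open>- \<alpha>\<close> is a root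
  of \<open>x\<^sup>2 = x + 1\<close>. Hence Fibonacci multiples of \<open>\<alpha>\<close> approach
  integers at a geometric rate, from alternating sides.\<close>

lemma golden_fib:
  fixes \<alpha> :: real
  assumes "\<alpha>\<^sup>2 + \<alpha> = 1"
  shows "real (fib (Suc m)) * \<alpha> - real (fib m) = (- 1) ^ m * \<alpha> ^ Suc m"
proof (induction m rule: fib.induct)
  case (3 m)
  have "real (fib (Suc (Suc (Suc m)))) * \<alpha> - real (fib (Suc (Suc m))) =
      (real (fib (Suc (Suc m))) * \<alpha> - real (fib (Suc m))) + (real (fib (Suc m)) * \<alpha> - real (fib m))"
    by (simp add: algebra_simps)
  also have "\<dots> = (- 1) ^ m * \<alpha> ^ Suc m * (1 - \<alpha>)"
    unfolding 3 by (simp add: algebra_simps)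
  also have "1 - \<alpha> = \<alpha>\<^sup>2" using assms by simp
  finally show ?case by (simp add: power2_eq_square mult_ac)
next
  case 2
  then show ?case using assms by (simp add: power2_eq_square)
qed simp

lemma fib_Suc_ge: "n \<le> fib (Suc (Suc n))"
proof (induction n)
  case (Suc n)
  have "fib (Suc n) > 0" by (rule fib_neq_0_nat) simp
  with Suc show ?case by simp
qed simp

context SU2_cocycle
begin

lemma iter_add_int: "iter n (x + real k * \<alpha>) = iter n (x + (real k * \<alpha> - real j))"
  using periodic_int[of "iter n" "x + (real k * \<alpha> - real j)" "int j", OF iter_periodic] by simp

lemma limit_add_int: "limit (x + real k * \<alpha>) = limit (x + (real k * \<alpha> - real j))"
  using periodic_int[of limit "x + (real k * \<alpha> - real j)" "int j", OF limit_periodic] by simp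

text \<open>Invariance of \<open>limit\<close> lets it pass through \<open>iter n x\<close> at the
  price of a translation by \<open>n * \<alpha>\<close>. So a return time at which
  \<open>limit\<close> nearly recurs gives a nearly commuting iterate.\<close>

lemma norm_commutator_limit:
  "norm (iter n x ** limit x - limit x ** iter n x) = norm (limit (x + real n * \<alpha>) - limit x)"
proof -
  have "limit x ** iter n x = iter n x ** limit (x + real n * \<alpha>) ** conj_transpose (iter n x) ** iter n x"
    using twist_limit[of n x] by (simp add: twist_def)
  also have "\<dots> = iter n x ** limit (x + real n * \<alpha>)"
    by (simp add: SU2_mult_conj_transpose iter_SU2 flip: matrix_mul_assoc)
  finally have "iter n x ** limit x - limit x ** iter n x = iter n x ** (limit x - limit (x + real n * \<alpha>))"
    by (simp add: matrix_mult.diff_right)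
  then show ?thesis
    by (simp add: norm_SU2_mult_left iter_SU2 norm_minus_commute)
qed

text \<open>The iterates at two consecutive Fibonacci times, taken at a good point, supply the
  approximate relations for every \<open>\<epsilon>\<close>.\<close>

lemma cos_degree_eq_1:
  assumes \<alpha>: "\<alpha> > 0" "\<alpha>\<^sup>2 + \<alpha> = 1"
    and c: "AE x in circle_measure. norm (limit x) = sqrt 2 * d" and d: "d > 0"
  shows "cos d = 1"
proof (rule cos_eq_1_of_almost_commuting[OF d])
  fix \<epsilon> :: real assume "\<epsilon> > 0"
  define e where "e = \<epsilon> / 3"
  have e: "e > 0" using \<open>\<epsilon> > 0\<close> by (simp add: e_def)
  obtain \<eta> N where \<eta>: "\<eta> > 0" and good: "\<And>n n' \<delta> \<delta>'. n \<ge> N \<Longrightarrow> n' \<ge> N \<Longrightarrow> \<bar>\<delta>\<bar> < \<eta> \<Longrightarrow> \<bar>\<delta>'\<bar> < \<eta> \<Longrightarrow>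
      \<exists>x. norm (limit x) = sqrt 2 * d \<and>
      (\<integral>s. norm (avg n' (x + s * \<delta>) - limit x) \<partial>circle_measure) < e \<and>
      (\<integral>s. norm (avg n (x + s * \<delta>') - limit x) \<partial>circle_measure) < e \<and>
      norm (limit (x + \<delta>) - limit x) < e \<and> norm (limit (x + \<delta>') - limit x) < e"
    using exists_good_point[OF c e] by blast
  have "\<alpha>\<^sup>2 > 0" using \<alpha>(1) by simp
  then have "\<alpha> < 1" using \<alpha>(2) by linarith
  then have "(\<lambda>m. \<alpha> ^ m) \<longlonglongrightarrow> 0"
    using \<alpha>(1) by (intro LIMSEQ_realpow_zero) auto
  then have "\<forall>\<^sub>F m in sequentially. \<alpha> ^ m < \<eta>"
    using \<eta> by (rule order_tendstoD(2))
  then obtain M where M: "\<And>m. m \<ge> M \<Longrightarrow> \<alpha> ^ m < \<eta>"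
    by (auto simp: eventually_sequentially)
  \<comment> \<open>With this offset \<open>fib_Suc_ge\<close> gives \<open>max M N \<le> q\<close>,
    so both return times are late enough and both displacements are small.\<close>
  define m where "m = Suc (max M N)"
  define q q' where "q = fib (Suc m)" and "q' = fib (Suc (Suc m))"
  define \<delta> \<delta>' where "\<delta> = real q * \<alpha> - real (fib m)" and "\<delta>' = real q' * \<alpha> - real q"
  have \<delta>_eq: "\<delta> = (- 1) ^ m * \<alpha> ^ Suc m" "\<delta>' = - ((- 1) ^ m) * \<alpha> ^ Suc (Suc m)"
    using golden_fib[OF \<alpha>(2), of m] golden_fib[OF \<alpha>(2), of "Suc m"]
    by (simp_all add: \<delta>_def \<delta>'_def q_def q'_def)
  have small: "\<bar>\<delta>\<bar> < \<eta>" "\<bar>\<delta>'\<bar> < \<eta>"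
    unfolding \<delta>_eq using M[of "Suc m"] M[of "Suc (Suc m)"] \<alpha>(1)
    by (simp_all add: abs_mult power_abs m_def)
  have "max M N \<le> q"
    unfolding q_def m_def by (rule fib_Suc_ge)
  moreover have "q \<le> q'"
    unfolding q_def q'_def by (rule fib_Suc_mono)
  moreover have "q > 0" unfolding q_def by (rule fib_neq_0_nat) simp
  ultimately have qN: "q \<ge> N" "q' \<ge> N" and q0: "q > 0" "q' > 0" by auto
  obtain x where x: "norm (limit x) = sqrt 2 * d"
      "(\<integral>s. norm (avg q' (x + s * \<delta>) - limit x) \<partial>circle_measure) < e"
      "(\<integral>s. norm (avg q (x + s * \<delta>') - limit x) \<partial>circle_measure) < e"
      "norm (limit (x + \<delta>) - limit x) < e" "norm (limit (x + \<delta>') - limit x) < e"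
    using good[OF qN small] by blast
  define P Q H s s' where "P = iter q x" and "Q = iter q' x" and "H = limit x"
    and "s = real q' * \<delta>" and "s' = real q * \<delta>'"
  have s_diff: "\<bar>s - s'\<bar> = 1"
  proof -
    \<comment> \<open>The mixed terms in \<open>\<alpha>\<close> cancel and an integer remains,
      which Cassini's identity evaluates.\<close>
    have "s - s' = of_int (int ((fib (Suc m))\<^sup>2) - int (fib (Suc (Suc m)) * fib m))"
      by (simp add: s_def s'_def \<delta>_def \<delta>'_def q_def q'_def power2_eq_square algebra_simps
          del: fib2)
    also have "int ((fib (Suc m))\<^sup>2) - int (fib (Suc (Suc m)) * fib m) = (- 1) ^ m"
      using fib_Cassini_int[of m] by linarith
    finally show ?thesis by (simp add: power_abs)
  qed
  \<comment> \<open>Consecutive displacements have opposite signs. Together with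
    \<open>\<bar>s - s'\<bar> = 1\<close> this bounds both numbers by 1.\<close>
  have "s * s' \<le> 0"
  proof -
    have "s * s' = - (real q * real q' * (((- 1) ^ m)\<^sup>2 * \<alpha> ^ Suc m * \<alpha> ^ Suc (Suc m)))"
      unfolding s_def s'_def \<delta>_eq power2_eq_square by (simp only: mult_minus_left mult_minus_right mult_ac)
    then show ?thesis using \<alpha>(1) by simp
  qed
  have s_le: "\<bar>s\<bar> \<le> 1" "\<bar>s'\<bar> \<le> 1"
  proof -
    have "s\<^sup>2 + s'\<^sup>2 \<le> \<bar>s - s'\<bar>\<^sup>2"
      using \<open>s * s' \<le> 0\<close> by (simp add: power2_diff) (simp add: mult.commute)
    then have "s\<^sup>2 \<le> 1" "s'\<^sup>2 \<le> 1"
      unfolding s_diff one_power2 using zero_le_power2[of s] zero_le_power2[of s'] by linarith+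
    then show "\<bar>s\<bar> \<le> 1" "\<bar>s'\<bar> \<le> 1" by (simp_all add: abs_square_le_1)
  qed
  \<comment> \<open>The iterate of order \<open>q + q'\<close> is split in both possible orders;
    periodicity replaces the full rotations by the small displacements.\<close>
  have "P ** iter q' (x + \<delta>) = iter (q + q') x"
    unfolding P_def \<delta>_def iter_add iter_add_int[of q' x q "fib m"] ..
  moreover have "Q ** iter q (x + \<delta>') = iter (q' + q) x"
    unfolding Q_def \<delta>'_def iter_add iter_add_int[of q x q' q] ..
  ultimately have comm: "P ** iter q' (x + \<delta>) = Q ** iter q (x + \<delta>')"
    by (simp add: add.commute)
  have H: "H \<in> su2" "norm H = sqrt 2 * d"
    by (simp_all add: H_def limit_su2 x)
  have "norm (iter q' (x + \<delta>) - su2_exp d H s ** Q) \<le> \<bar>s\<bar> * (\<integral>t. norm (avg q' (x + t * \<delta>) - H) \<partial>circle_measure)"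
    unfolding s_def Q_def by (rule iter_shift_approx[OF q0(2) H d])
  also have "\<dots> \<le> 1 * (\<integral>t. norm (avg q' (x + t * \<delta>) - H) \<partial>circle_measure)"
    by (intro mult_right_mono s_le) simp
  also have "\<dots> < e" using x(2) by (simp add: H_def)
  finally have 1: "norm (iter q' (x + \<delta>) - su2_exp d H s ** Q) < e" .
  have "norm (iter q (x + \<delta>') - su2_exp d H s' ** P) \<le> \<bar>s'\<bar> * (\<integral>t. norm (avg q (x + t * \<delta>') - H) \<partial>circle_measure)"
    unfolding s'_def P_def by (rule iter_shift_approx[OF q0(1) H d])
  also have "\<dots> \<le> 1 * (\<integral>t. norm (avg q (x + t * \<delta>') - H) \<partial>circle_measure)"
    by (intro mult_right_mono s_le) simp
  also have "\<dots> < e" using x(3) by (simp add: H_def)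
  finally have 2: "norm (iter q (x + \<delta>') - su2_exp d H s' ** P) < e" .
  \<comment> \<open>The exact relation \<open>comm\<close> cancels the main terms. What remains are
    the two shift errors, each multiplied by a unitary matrix.\<close>
  have "P ** su2_exp d H s ** Q - Q ** su2_exp d H s' ** P =
      Q ** (iter q (x + \<delta>') - su2_exp d H s' ** P) - P ** (iter q' (x + \<delta>) - su2_exp d H s ** Q)"
    using comm by (simp add: matrix_mult.diff_right matrix_mul_assoc)
  then have "norm (P ** su2_exp d H s ** Q - Q ** su2_exp d H s' ** P) \<le>
      norm (Q ** (iter q (x + \<delta>') - su2_exp d H s' ** P)) + norm (P ** (iter q' (x + \<delta>) - su2_exp d H s ** Q))"
    by (simp add: norm_triangle_ineq4)
  also have "\<dots> < e + e"
    using 1 2 by (simp add: P_def Q_def norm_SU2_mult_left iter_SU2)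
  also have "\<dots> < \<epsilon>" using e by (simp add: e_def)
  finally have 3: "norm (P ** su2_exp d H s ** Q - Q ** su2_exp d H s' ** P) < \<epsilon>" .
  have "norm (P ** H - H ** P) < e" "norm (Q ** H - H ** Q) < e"
    unfolding P_def Q_def H_def norm_commutator_limit limit_add_int[of x q "fib m"] limit_add_int[of x q' q]
    using x(4,5) by (simp_all add: \<delta>_def \<delta>'_def)
  moreover have "e < \<epsilon>" using e by (simp add: e_def)
  ultimately have 4: "norm (P ** H - H ** P) < \<epsilon>" "norm (Q ** H - H ** Q) < \<epsilon>" by linarith+
  have "P \<in> SU2" "Q \<in> SU2" by (simp_all add: P_def Q_def iter_SU2)
  then show "\<exists>P\<in>SU2. \<exists>Q\<in>SU2. \<exists>H\<in>su2. \<exists>s s'. norm H = sqrt 2 * d \<and>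
        \<bar>s\<bar> \<le> 1 \<and> \<bar>s'\<bar> \<le> 1 \<and> \<bar>s - s'\<bar> = 1 \<and>
        norm (P ** H - H ** P) < \<epsilon> \<and> norm (Q ** H - H ** Q) < \<epsilon> \<and>
        norm (P ** su2_exp d H s ** Q - Q ** su2_exp d H s' ** P) < \<epsilon>"
    using H s_le s_diff 3 4 by (intro bexI[of _ P] bexI[of _ Q] bexI[of _ H] exI[of _ s] exI[of _ s'] conjI)
qed

end

section \<open>The degree over the golden rotation\<close>

theorem theorem7p3:
  fixes \<alpha> :: real and \<phi> :: "real \<Rightarrow> complex^2^2"
  assumes "\<alpha> > 0" and "\<alpha>\<^sup>2 + \<alpha> = 1"
    and "C2_cocycle \<phi>"
  shows "cocycle_degree \<alpha> \<phi> \<in> {2 * pi * real k | k :: nat. True}"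
proof -
  interpret SU2_cocycle \<alpha> \<phi> by unfold_locales (rule assms(3))
  \<comment> \<open>Fibonacci multiples of \<open>\<alpha>\<close> reduced modulo 1 are arbitrarily
    small nonzero periods of \<open>norm (limit x)\<close>, as ergodicity requires.\<close>
  have "\<exists>\<tau>. 0 < \<bar>\<tau>\<bar> \<and> \<bar>\<tau>\<bar> < \<eta> \<and> (\<forall>x. norm (limit (x + \<tau>)) = norm (limit x))" if \<eta>: "\<eta> > 0" for \<eta>
  proof -
    have "\<alpha>\<^sup>2 > 0" using assms(1) by simp
    then have "\<alpha> < 1" using assms(2) by linarith
    from real_arch_pow_inv[OF \<eta> this] obtain m where "\<alpha> ^ m < \<eta>" by blast
    moreover have "\<alpha> ^ Suc m \<le> \<alpha> ^ m"
      using assms(1) \<open>\<alpha> < 1\<close> by (intro power_decreasing) auto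
    ultimately have m: "\<alpha> ^ Suc m < \<eta>" by linarith
    define \<tau> where "\<tau> = real (fib (Suc m)) * \<alpha> - real (fib m)"
    have "\<bar>\<tau>\<bar> = \<alpha> ^ Suc m"
      unfolding \<tau>_def golden_fib[OF assms(2)] using assms(1) by (simp add: abs_mult power_abs)
    moreover have "norm (limit (x + \<tau>)) = norm (limit x)" for x
      unfolding \<tau>_def limit_add_int[symmetric] by (rule limit_shift)
    ultimately show ?thesis
      using m assms(1) by (intro exI[of _ \<tau>]) simp
  qed
  from AE_norm_limit_const[OF this] obtain c where c: "AE x in circle_measure. norm (limit x) = c"
    by blast
  define d where "d = c / sqrt 2"
  have cd: "c = sqrt 2 * d" by (simp add: d_def)
  have deg: "cocycle_degree \<alpha> \<phi> = d"
    using c unfolding cd by (rule cocycle_degree_eq)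
  from AE_circle_exists[OF c] have "c \<ge> 0"
    using norm_ge_zero by metis
  then have "d \<ge> 0" by (simp add: d_def)
  show ?thesis
  \<comment> \<open>Degree zero is the case \<open>k = 0\<close>. The centralizer argument needs a
    nonzero \<open>H\<close>, hence \<open>d > 0\<close>.\<close>
  proof (cases "d = 0")
    case True
    then show ?thesis unfolding deg by (auto intro!: exI[of _ 0])
  next
    case False
    with \<open>d \<ge> 0\<close> have "d > 0" by simp
    with c assms have "cos d = 1"
      unfolding cd by (intro cos_degree_eq_1) auto
    then obtain k :: int where k: "d = of_int k * 2 * pi"
      by (auto simp: cos_one_2pi_int)
    with \<open>d > 0\<close> have "k > 0"
      by (simp add: zero_less_mult_iff)
    then have "d = 2 * pi * real (nat k)"
      using k by simp
    then show ?thesis unfolding deg by blast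
  qed
qed

end
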